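(* Let $0<m\le M<\infty$ and let a real-valued $(q,V,\Gamma)\in PC_{\delta,m,M,ap}(\mathbb{R})$ be fixed. Then its rotation number $\rho(E)$ is continuous with respect to $E\in\mathbb{R}$.
   Context: $\mathbb{K}$ is $\mathbb{R}$ or $\mathbb{C}$, $\mathbb{N}_0=\{0,1,2,\dots\}$. **Point sets.** For $0<m\le M<\infty$, $L_{m,M}(\mathbb{Z})$ is the set of all $\Gamma=\{x_i\}_{i\in\mathbb{Z}}\subset\mathbb{R}$ with $x_0=0$ and $x_i-x_{i-1}\in[m,M]$ for all $i$, with metric $\mathrm{dist}(\Gamma_1,\Gamma_2)=\max\{\sup_i\min_j|x_i^1-x_j^2|,\ \sup_i\min_j|x_i^2-x_j^1|\}$ for $\Gamma_k=\{x_i^k\}$. For $\tau\in\mathbb{Z}$, $\Gamma\cdot\tau:=\{x_{i+\tau}-x_\tau\}_{i\in\mathbb{Z}}$. For a bounded bi-sequence $V=\{v_i\}_{i\in\mathbb{Z}}\in\ell^\infty(\mathbb{Z})$, $V\cdot\tau:=\{v_{i+\tau}\}_{i\in\mathbb{Z}}$. **Functions with jumps and $\delta$-interactions.** $PC_{u,\delta,m,M}(\mathbb{R})$ is the set of triples $(f,V,\Gamma)$ with $\Gamma\in L_{m,M}(\mathbb{Z})$, $V\in\ell^\infty(\mathbb{Z})$, and $f:\mathbb{R}\setminus\Gamma\to\mathbb{K}$ bounded and such that for every $\varepsilon>0$ there is $\delta>0$ with $|f(x)-f(y)|<\varepsilon$ whenever $|x-y|<\delta$ and $x,y$ lie in the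 same component interval of $\mathbb{R}\setminus\Gamma$. The triple represents $f(x)+\sum_i v_i\delta(x-x_i)$. For $A\subset\mathbb{R}$, $F_r(A)=\{x:|x-y|\le r\text{ for some }y\in A\}$. Let $S_r$ ($r>0$) be the set of pairs $((f_1,V_1,\Gamma_1),(f_2,V_2,\Gamma_2))$ with $\mathrm{dist}(\Gamma_1,\Gamma_2)<r$, $\|V_1-V_2\|_\infty<r$ and $|f_1(x)-f_2(x)|<r$ for all $x\in\mathbb{R}\setminus F_r(\Gamma_1\cup\Gamma_2)$; let $U_0$ be the set of all pairs and $U_n=S_{4^{-n}}$ for $n\ge1$. The family $\{U_n\}_{n\in\mathbb{N}_0}$ is a base of a metrizable uniformity; $\mathrm{dist}$ denotes a fixed metric on $PC_{u,\delta,m,M}(\mathbb{R})$ inducing it, with $U_n\subset\{\mathrm{dist}<2^{-n}\}\subset U_{n-1}$ for all $n\ge1$. The shift is $(f,V,\Gamma)\cdot\tau:=(f(\cdot+x_\tau),V\cdot\tau,\Gamma\cdot\tau)$, $\tau\in\mathbb{Z}$, and the hull $\mathrm{H}((f,V,\Gamma))$ is the closure of $\{(f,V,\Gamma)\cdot\tau:\tau\in\mathbb{Z}\}$ in $(PC_{u,\delta,m,M}(\mathbb{R}),\mathrm{dist})$. $PC_{\delta,m,M,ap}(\mathbb{R})$ is the set of $(f,V,\Gamma)$ that are almost periodic, i.e. whose hull is compact (equivalently, every sequence of shifts has a convergent subsequence). **Angle function.** For $c,\Xi\in\mathbb{R}$, $\tau\in[0,1]$ let $F(c,\tau,\Xi)$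 be the continuous branch of $\arg(\cos\Xi+\tau c\sin\Xi+\mathrm{i}\sin\Xi)$ with $F(c,0,\Xi)=\Xi$, and set $J(c,\Xi):=F(c,1,\Xi)-F(c,0,\Xi)$. For $(q,V,\Gamma)$ real-valued with $\Gamma=\{x_n\}$, $V=\{v_n\}$, and $E,\Xi\in\mathbb{R}$, $\theta_E(x)=\theta_E(x;(q,V,\Gamma),\Xi)$, $x\in\mathbb{R}$, is the right-continuous solution with $\theta_E(0)=\Xi$ of $\theta'(x)=\cos^2\theta(x)-(q(x)-E)\sin^2\theta(x)$ for $x\in\mathbb{R}\setminus\Gamma$, $\theta(x_n+)-\theta(x_n-)=J(v_n,\theta(x_n-))$ for $x_n\in\Gamma$. It is the Prüfer angle $\arg(\psi'+\mathrm{i}\psi)$ of solutions of $-\psi''+(q+\sum_n v_n\delta(\cdot-x_n))\psi=E\psi$. **Rotation number.** $\rho(E):=\lim_{x\to+\infty}\frac{\theta_E(x;(q,V,\Gamma),\Xi)-\Xi}{x}$; for $(q,V,\Gamma)\in PC_{\delta,m,M,ap}(\mathbb{R})$ this limit exists for every $E\in\mathbb{R}$ and does not depend on $\Xi\in\mathbb{R}$. *)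

theory Defs
  imports "HOL-Analysis.Analysis"
begin

section \<open>Point sets\<close>

text \<open>
  A point set is represented by its increasing enumeration \<open>G :: int \<Rightarrow> real\<close> normalised by
  \<open>G 0 = 0\<close>, which it determines uniquely; the set itself is \<open>range G\<close>.
\<close>

definition point_sets :: "real \<Rightarrow> real \<Rightarrow> (int \<Rightarrow> real) set" where
  "point_sets m M = {G. G 0 = 0 \<and> (\<forall>i. G i - G (i - 1) \<in> {m..M})}"

definition point_set_dist :: "(int \<Rightarrow> real) \<Rightarrow> (int \<Rightarrow> real) \<Rightarrow> real" where
  "point_set_dist G H =
     max (SUP i. INF j. \<bar>G i - H j\<bar>) (SUP i. INF j. \<bar>H i - G j\<bar>)"

definition bishift :: "(int \<Rightarrow> 'a) \<Rightarrow> int \<Rightarrow> int \<Rightarrow> 'a" where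
  "bishift V \<tau> = (\<lambda>i. V (i + \<tau>))"

definition point_set_shift :: "(int \<Rightarrow> real) \<Rightarrow> int \<Rightarrow> int \<Rightarrow> real" where
  "point_set_shift G \<tau> = (\<lambda>i. G (i + \<tau>) - G \<tau>)"

section \<open>Piecewise continuous functions with delta-interactions\<close>

text \<open>
  The scalar type \<open>'k\<close> is meant to be \<open>real\<close> or \<open>complex\<close>. A function on the complement of
  \<open>range G\<close> is a total function in \<open>extensional (- range G)\<close>, so that two triples are equal iff
  they are equal as mathematical objects.
\<close>

type_synonym 'k pc_triple = "(real \<Rightarrow> 'k) \<times> (int \<Rightarrow> 'k) \<times> (int \<Rightarrow> real)"

definition PC :: "real \<Rightarrow> real \<Rightarrow> 'k::real_normed_field pc_triple set" where
  "PC m M = {(f, V, G).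
     G \<in> point_sets m M \<and> bounded (range V) \<and>
     f \<in> extensional (- range G) \<and> bounded (f ` (- range G)) \<and>
     (\<forall>\<epsilon>>0. \<exists>\<delta>>0. \<forall>x y. connected_component (- range G) x y \<and> \<bar>x - y\<bar> < \<delta>
        \<longrightarrow> norm (f x - f y) < \<epsilon>)}"

definition fattening :: "real \<Rightarrow> real set \<Rightarrow> real set" where
  "fattening r A = {x. \<exists>y\<in>A. \<bar>x - y\<bar> \<le> r}"

definition entourage_S ::
    "real \<Rightarrow> real \<Rightarrow> real \<Rightarrow> ('k::real_normed_field pc_triple \<times> 'k pc_triple) set" where
  "entourage_S m M r = {((f, V, G), (g, W, H)).
     (f, V, G) \<in> PC m M \<and> (g, W, H) \<in> PC m M \<and>
     point_set_dist G H < r \<and>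
     (SUP i. norm (V i - W i)) < r \<and>
     (\<forall>x. x \<notin> fattening r (range G \<union> range H) \<longrightarrow> norm (f x - g x) < r)}"

definition entourage_U ::
    "real \<Rightarrow> real \<Rightarrow> nat \<Rightarrow> ('k::real_normed_field pc_triple \<times> 'k pc_triple) set" where
  "entourage_U m M n =
     (if n = 0 then PC m M \<times> PC m M else entourage_S m M (1 / 4 ^ n))"

text \<open>
  The two inclusions force \<open>d\<close> to induce the uniformity with base \<open>entourage_U m M\<close>. Existence of
  such a \<open>d\<close> is the usual metrization lemma, since three-fold composites of
  \<open>entourage_S m M r\<close> lie in \<open>entourage_S m M (4 * r)\<close>.
\<close>

definition PC_metric ::
    "real \<Rightarrow> real \<Rightarrow> ('k::real_normed_field pc_triple \<Rightarrow> 'k pc_triple \<Rightarrow> real) \<Rightarrow> bool" where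
  "PC_metric m M d \<longleftrightarrow>
     Metric_space (PC m M) d \<and>
     (\<forall>n\<ge>1.
        entourage_U m M n \<subseteq> {(p, p'). p \<in> PC m M \<and> p' \<in> PC m M \<and> d p p' < 1 / 2 ^ n} \<and>
        {(p, p'). p \<in> PC m M \<and> p' \<in> PC m M \<and> d p p' < 1 / 2 ^ n} \<subseteq> entourage_U m M (n - 1))"

fun pc_shift :: "'k pc_triple \<Rightarrow> int \<Rightarrow> 'k pc_triple" where
  "pc_shift (f, V, G) \<tau> = ((\<lambda>x. f (x + G \<tau>)), bishift V \<tau>, point_set_shift G \<tau>)"

definition pc_hull ::
    "real \<Rightarrow> real \<Rightarrow> ('k::real_normed_field pc_triple \<Rightarrow> 'k pc_triple \<Rightarrow> real)
      \<Rightarrow> 'k pc_triple \<Rightarrow> 'k pc_triple set" where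
  "pc_hull m M d p = Metric_space.mtopology (PC m M) d closure_of range (pc_shift p)"

definition PC_ap ::
    "real \<Rightarrow> real \<Rightarrow> ('k::real_normed_field pc_triple \<Rightarrow> 'k pc_triple \<Rightarrow> real)
      \<Rightarrow> 'k pc_triple set" where
  "PC_ap m M d =
     {p \<in> PC m M. compactin (Metric_space.mtopology (PC m M) d) (pc_hull m M d p)}"

section \<open>Pruefer angle and rotation number\<close>

text \<open>
  The branch of the argument is the continuous lift along the path in \<open>t\<close> that starts at \<open>\<Xi>\<close>;
  it is unique because the complex number below never vanishes.
\<close>

definition angle_F :: "real \<Rightarrow> real \<Rightarrow> real \<Rightarrow> real" where
  "angle_F c \<tau> \<Xi> = (THE y. \<exists>\<phi>.
     continuous_on {0..1} \<phi> \<and> \<phi> 0 = \<Xi> \<and>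
     (\<forall>t\<in>{0..1}. is_Arg (Complex (cos \<Xi> + t * c * sin \<Xi>) (sin \<Xi>)) (\<phi> t)) \<and>
     y = \<phi> \<tau>)"

definition angle_J :: "real \<Rightarrow> real \<Rightarrow> real" where
  "angle_J c \<Xi> = angle_F c 1 \<Xi> - angle_F c 0 \<Xi>"

definition pruefer_solution ::
    "real pc_triple \<Rightarrow> real \<Rightarrow> real \<Rightarrow> (real \<Rightarrow> real) \<Rightarrow> bool" where
  "pruefer_solution = (\<lambda>(q, V, G) E \<Xi> \<theta>.
     \<theta> 0 = \<Xi> \<and>
     (\<forall>x. continuous (at_right x) \<theta>) \<and>
     (\<forall>x. x \<notin> range G \<longrightarrow>
        (\<theta> has_real_derivative (cos (\<theta> x))\<^sup>2 - (q x - E) * (sin (\<theta> x))\<^sup>2) (at x)) \<and>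
     (\<forall>n. \<exists>l r. (\<theta> \<longlongrightarrow> l) (at_left (G n)) \<and> (\<theta> \<longlongrightarrow> r) (at_right (G n)) \<and>
        r - l = angle_J (V n) l))"

definition pruefer_angle :: "real pc_triple \<Rightarrow> real \<Rightarrow> real \<Rightarrow> real \<Rightarrow> real" where
  "pruefer_angle p E \<Xi> = (THE \<theta>. pruefer_solution p E \<Xi> \<theta>)"

text \<open>The limit is required to be the same for all initial angles \<open>\<Xi>\<close>.\<close>

definition rotation_number :: "real pc_triple \<Rightarrow> real \<Rightarrow> real" where
  "rotation_number p E =
     (THE \<rho>. \<forall>\<Xi>. ((\<lambda>x. (pruefer_angle p E \<Xi> x - \<Xi>) / x) \<longlongrightarrow> \<rho>) at_top)"

end

theory Submission
  imports Defs
begin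

text \<open>
  The angle is sampled at the points of \<open>G\<close>. Between two points the Pruefer equation
  \<open>\<theta>' = cos\<^sup>2 \<theta> - (q - E) sin\<^sup>2 \<theta>\<close> is globally Lipschitz in \<open>\<theta>\<close>; the jump at a point turns out to be the
  time-one map of the equation \<open>\<theta>' = - v sin\<^sup>2 \<theta>\<close> of the same shape (\<open>angle_J_transport\<close>). So the value
  just after one point is carried to the value just after the next by a map \<open>step n\<close>, and one family
  of Gronwall estimates shows that these maps are increasing bijections of the line that commute with
  the translation by \<open>\<pi>\<close> and are Lipschitz uniformly in \<open>n\<close>. Bijectivity lets the node values be
  continued to the left of 0 as well, which makes the Pruefer angle well defined
  (\<open>pruefer_angle_solution\<close>).

  Let \<open>D E n t\<close> be the displacement of 0 under \<open>n\<close> steps that begin at node \<open>t\<close>. Monotone maps that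
  commute with the translation by \<open>\<pi>\<close> displace any two points by amounts differing by at most \<open>\<pi>\<close>,
  hence \<open>D\<close> is additive up to \<open>\<pi>\<close>: \<open>D E (k N) 0\<close> is the sum of the \<open>k\<close> block displacements
  \<open>D E N (j N)\<close> up to an error \<open>k \<pi>\<close>. For fixed \<open>E\<close> and \<open>N\<close> the displacement \<open>D E N t\<close> almost repeats
  itself when \<open>t\<close> is moved by an almost period of the triple, and compactness of the hull makes the
  almost periods relatively dense. These two properties alone force \<open>D E n 0 / n\<close> to converge
  (\<open>quasi_cocycle_convergent\<close>), to \<open>\<beta> E\<close> say. The same argument for the exactly additive \<open>G (t + n) - G t\<close>
  gives the mean gap \<open>\<gamma> > 0\<close>, and the rotation number is \<open>\<beta> E / \<gamma>\<close>.

  Continuity in \<open>E\<close> needs no further almost periodicity. If \<open>\<bar>D E N t - D E' N t\<bar> \<le> 1\<close> for all \<open>t\<close>,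
  which holds for \<open>E'\<close> near \<open>E\<close> because the Lipschitz constants are uniform in \<open>t\<close>, then comparing
  blocks gives \<open>\<bar>\<beta> E - \<beta> E'\<bar> \<le> (2 \<pi> + 1) / N\<close> (\<open>quasi_cocycle_mean_close\<close>). Taking \<open>N\<close> large first and
  then \<open>E'\<close> close to \<open>E\<close> finishes the proof.
\<close>

section \<open>Linear growth estimates and global solutions of Lipschitz equations\<close>


text \<open>
  The derivative is only required on the open interval, since \<open>q\<close> has no values at the points of
  \<open>G\<close>. With \<open>A = 1\<close> and \<open>b = q - E\<close> this is the equation between two points; with \<open>A = 0\<close> and \<open>b\<close>
  constant it is the flow whose time-one map is the jump.
\<close>

definition pruefer_arc :: "real \<Rightarrow> (real \<Rightarrow> real) \<Rightarrow> real \<Rightarrow> real \<Rightarrow> (real \<Rightarrow> real) \<Rightarrow> bool" where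
  "pruefer_arc A b \<alpha> \<beta> u \<longleftrightarrow> continuous_on {\<alpha>..\<beta>} u \<and>
     (\<forall>x\<in>{\<alpha><..<\<beta>}. (u has_real_derivative A * (cos (u x))\<^sup>2 - b x * (sin (u x))\<^sup>2) (at x))"

text \<open>
  Passing to \<open>w\<^sup>2\<close> avoids the points where \<open>\<bar>w\<bar>\<close> is not differentiable. There
  \<open>(w\<^sup>2)' \<le> 2 L w\<^sup>2 + 2 e \<bar>w\<bar> \<le> (2 L + 1) w\<^sup>2 + e\<^sup>2\<close>, so \<open>w\<^sup>2\<close> times a decaying exponential grows at most linearly
  with slope \<open>e\<^sup>2\<close>. The rate \<open>2 L + 1\<close> is not optimal but any fixed rate serves.
\<close>

lemma gronwall_square:
  fixes w w' :: "real \<Rightarrow> real"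
  assumes ab: "\<alpha> \<le> \<beta>" and L: "0 \<le> L" and e: "0 \<le> e"
    and cont: "continuous_on {\<alpha>..\<beta>} w"
    and der: "\<And>x. \<alpha> < x \<Longrightarrow> x < \<beta> \<Longrightarrow> (w has_real_derivative w' x) (at x)"
    and bnd: "\<And>x. \<alpha> < x \<Longrightarrow> x < \<beta> \<Longrightarrow> \<bar>w' x\<bar> \<le> L * \<bar>w x\<bar> + e"
  shows "(w \<beta>)\<^sup>2 \<le> exp ((2 * L + 1) * (\<beta> - \<alpha>)) * ((w \<alpha>)\<^sup>2 + e\<^sup>2 * (\<beta> - \<alpha>))"
proof -
  define k where "k = 2 * L + 1"
  \<comment> \<open>\<open>h' \<le> 0\<close> is the differential inequality for \<open>w\<^sup>2\<close> after multiplication by the exponential\<close>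
  define h where "h x = exp (- (k * (x - \<alpha>))) * (w x)\<^sup>2 - e\<^sup>2 * (x - \<alpha>)" for x
  have "h \<beta> \<le> h \<alpha>"
  proof (rule DERIV_nonpos_imp_decreasing_open[OF ab])
    fix x assume x: "\<alpha> < x" "x < \<beta>"
    let ?d = "exp (- (k * (x - \<alpha>))) * (2 * w x * w' x - k * (w x)\<^sup>2) - e\<^sup>2"
    have "(h has_real_derivative ?d) (at x)"
      unfolding h_def
      by (rule derivative_eq_intros der[OF x] refl | simp add: power2_eq_square algebra_simps)+
    moreover have "?d \<le> 0"
    proof -
      have "2 * w x * w' x \<le> 2 * \<bar>w x\<bar> * (L * \<bar>w x\<bar> + e)"
      proof -
        have "w x * w' x \<le> \<bar>w x\<bar> * \<bar>w' x\<bar>" by (metis abs_ge_self abs_mult)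
        also have "\<dots> \<le> \<bar>w x\<bar> * (L * \<bar>w x\<bar> + e)" using bnd[OF x] by (intro mult_left_mono) auto
        finally show ?thesis by simp
      qed
      also have "\<dots> = 2 * L * (w x)\<^sup>2 + 2 * \<bar>w x\<bar> * e"
        by (simp add: algebra_simps power2_eq_square)
      also have "\<dots> \<le> 2 * L * (w x)\<^sup>2 + ((w x)\<^sup>2 + e\<^sup>2)"
        using sum_squares_bound[of "\<bar>w x\<bar>" e] by simp
      finally have A: "2 * w x * w' x - k * (w x)\<^sup>2 \<le> e\<^sup>2" by (simp add: k_def algebra_simps)
      have "0 < k * (x - \<alpha>)" using L x by (simp add: k_def)
      then have "exp (- (k * (x - \<alpha>))) \<le> 1" by simp
      then have "exp (- (k * (x - \<alpha>))) * (2 * w x * w' x - k * (w x)\<^sup>2) \<le> 1 * e\<^sup>2"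
        using A mult_left_mono[OF A, of "exp (- (k * (x - \<alpha>)))"]
          mult_right_mono[of "exp (- (k * (x - \<alpha>)))" 1 "e\<^sup>2"]
        by (metis order_trans exp_ge_zero zero_le_power2)
      then show ?thesis by simp
    qed
    ultimately show "\<exists>y. (h has_real_derivative y) (at x) \<and> y \<le> 0" by blast
  next
    show "continuous_on {\<alpha>..\<beta>} h" unfolding h_def by (intro continuous_intros cont)
  qed
  then have "exp (- (k * (\<beta> - \<alpha>))) * (w \<beta>)\<^sup>2 \<le> (w \<alpha>)\<^sup>2 + e\<^sup>2 * (\<beta> - \<alpha>)" by (simp add: h_def)
  from mult_left_mono[OF this, of "exp (k * (\<beta> - \<alpha>))"]
  show ?thesis by (simp add: exp_minus k_def flip: mult.assoc)
qed

lemma gronwall: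
  fixes w w' :: "real \<Rightarrow> real"
  assumes ab: "\<alpha> \<le> \<beta>" and L: "0 \<le> L" and e: "0 \<le> e"
    and cont: "continuous_on {\<alpha>..\<beta>} w"
    and der: "\<And>x. \<alpha> < x \<Longrightarrow> x < \<beta> \<Longrightarrow> (w has_real_derivative w' x) (at x)"
    and bnd: "\<And>x. \<alpha> < x \<Longrightarrow> x < \<beta> \<Longrightarrow> \<bar>w' x\<bar> \<le> L * \<bar>w x\<bar> + e"
  shows "\<bar>w \<beta>\<bar> \<le> exp ((2 * L + 1) * (\<beta> - \<alpha>)) * (\<bar>w \<alpha>\<bar> + e * (1 + (\<beta> - \<alpha>)))"
proof (rule power2_le_imp_le)
  let ?l = "\<beta> - \<alpha>"
  let ?X = "exp ((2 * L + 1) * ?l)"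
  have X: "?X \<le> ?X\<^sup>2"
  proof -
    have "1 \<le> ?X" using L ab by simp
    then show ?thesis using mult_left_mono[of 1 ?X ?X] by (simp add: power2_eq_square)
  qed
  have "t \<le> (1 + t)\<^sup>2" if "0 \<le> t" for t :: real
    using that by (simp add: power2_eq_square algebra_simps add_increasing)
  then have l: "?l \<le> (1 + ?l)\<^sup>2" using ab by simp
  have "(w \<alpha>)\<^sup>2 + e\<^sup>2 * ?l \<le> (w \<alpha>)\<^sup>2 + e\<^sup>2 * (1 + ?l)\<^sup>2"
    using mult_left_mono[OF l, of "e\<^sup>2"] by simp
  also have "\<dots> \<le> (\<bar>w \<alpha>\<bar> + e * (1 + ?l))\<^sup>2"
    using e ab by (simp add: power2_sum power_mult_distrib)
  finally have *: "(w \<alpha>)\<^sup>2 + e\<^sup>2 * ?l \<le> (\<bar>w \<alpha>\<bar> + e * (1 + ?l))\<^sup>2" .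
  have "(w \<beta>)\<^sup>2 \<le> ?X * ((w \<alpha>)\<^sup>2 + e\<^sup>2 * ?l)"
    by (rule gronwall_square[OF assms])
  also have "\<dots> \<le> ?X\<^sup>2 * (\<bar>w \<alpha>\<bar> + e * (1 + ?l))\<^sup>2"
    using * X ab by (intro mult_mono) auto
  finally show "\<bar>w \<beta>\<bar>\<^sup>2 \<le> (?X * (\<bar>w \<alpha>\<bar> + e * (1 + ?l)))\<^sup>2"
    by (simp add: power_mult_distrib)
  show "0 \<le> ?X * (\<bar>w \<alpha>\<bar> + e * (1 + ?l))" using e ab by simp
qed

text \<open>
  Reflecting the interval exchanges its ends. This direction gives injectivity of the solution maps.
\<close>

lemma gronwall_backward:
  fixes w w' :: "real \<Rightarrow> real"
  assumes ab: "\<alpha> \<le> \<beta>" and L: "0 \<le> L" and e: "0 \<le> e"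
    and cont: "continuous_on {\<alpha>..\<beta>} w"
    and der: "\<And>x. \<alpha> < x \<Longrightarrow> x < \<beta> \<Longrightarrow> (w has_real_derivative w' x) (at x)"
    and bnd: "\<And>x. \<alpha> < x \<Longrightarrow> x < \<beta> \<Longrightarrow> \<bar>w' x\<bar> \<le> L * \<bar>w x\<bar> + e"
  shows "\<bar>w \<alpha>\<bar> \<le> exp ((2 * L + 1) * (\<beta> - \<alpha>)) * (\<bar>w \<beta>\<bar> + e * (1 + (\<beta> - \<alpha>)))"
proof -
  have "continuous_on {- \<beta>..- \<alpha>} (\<lambda>x. w (- x))"
    by (rule continuous_on_compose2[OF cont]) (auto intro!: continuous_intros)
  moreover have "((\<lambda>x. w (- x)) has_real_derivative - w' (- x)) (at x)"
    if "- \<beta> < x" "x < - \<alpha>" for x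
    using der[of "- x"] that by (simp add: DERIV_mirror)
  ultimately show ?thesis
    using gronwall[of "- \<beta>" "- \<alpha>" L e "\<lambda>x. w (- x)" "\<lambda>x. - w' (- x)"] assms by simp
qed

text \<open>
  The Picard operator is applied to \<open>y x = exp (- 2 L (x - \<alpha>)) u x\<close> instead of \<open>u\<close>. In the supremum norm of
  \<open>y\<close> it is a contraction with factor 1/2 however long the interval is, so no short solutions have to be
  glued. Functions on the interval are represented by bounded continuous functions on the line, the
  operator reading its argument through the retraction \<open>c\<close> onto \<open>[\<alpha>, \<beta>]\<close>.
\<close>

lemma picard:
  fixes g :: "real \<Rightarrow> real \<Rightarrow> real"
  assumes ab: "\<alpha> \<le> \<beta>" and L: "0 < L"
    and cont: "continuous_on UNIV (\<lambda>z. g (fst z) (snd z))"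
    and lip: "\<And>x y z. \<bar>g x y - g x z\<bar> \<le> L * \<bar>y - z\<bar>"
  obtains u where "u \<alpha> = \<xi>"
    "\<And>x. x \<in> {\<alpha>..\<beta>} \<Longrightarrow> (u has_real_derivative g x (u x)) (at x within {\<alpha>..\<beta>})"
proof -
  define c where "c x = max \<alpha> (min \<beta> x)" for x
  define l where "l = 2 * L"
  define h where "h y t = g t (exp (l * (t - \<alpha>)) * y t)" for y :: "real \<Rightarrow> real" and t
  \<comment> \<open>the operator \<open>u \<mapsto> \<xi> + \<integral> g t (u t) dt\<close>, conjugated by the weight\<close>
  define T where "T y x = exp (- (l * (c x - \<alpha>))) * (\<xi> + integral {\<alpha>..c x} (h y))" for y x
  have cr: "c x \<in> {\<alpha>..\<beta>}" for x using ab by (auto simp: c_def)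
  have cc: "continuous_on UNIV c" unfolding c_def by (intro continuous_intros)
  have hc: "continuous_on S (h (apply_bcontfun y))" for y S
    unfolding h_def
    using continuous_on_compose2[OF cont, of S "\<lambda>t. (t, exp (l * (t - \<alpha>)) * apply_bcontfun y t)"]
    by (simp add: continuous_intros)
  have hi: "h (apply_bcontfun y) integrable_on {r..s}" for y r s
    by (rule integrable_continuous_real[OF hc])
  have Tb: "T (apply_bcontfun y) \<in> bcontfun" for y
  proof -
    define k where "k s = exp (- (l * (s - \<alpha>))) * (\<xi> + integral {\<alpha>..s} (h (apply_bcontfun y)))" for s
    have k: "continuous_on {\<alpha>..\<beta>} k"
      unfolding k_def by (intro continuous_intros indefinite_integral_continuous_1 hi)
    have Tk: "T (apply_bcontfun y) = (\<lambda>x. k (c x))" by (simp add: T_def k_def fun_eq_iff)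
    have "bounded (k ` {\<alpha>..\<beta>})"
      by (intro compact_imp_bounded compact_continuous_image k) auto
    then obtain B where "\<forall>s\<in>{\<alpha>..\<beta>}. norm (k s) \<le> B" by (auto simp: bounded_iff)
    then show ?thesis unfolding Tk
      by (intro bcontfun_normI[where b = B] continuous_on_compose2[OF k cc]) (use cr in auto)
  qed
  define F where "F y = Bcontfun (T (apply_bcontfun y))" for y
  have F: "apply_bcontfun (F y) = T (apply_bcontfun y)" for y
    by (simp add: F_def Bcontfun_inverse Tb)
  have "dist (F y) (F z) \<le> 1 / 2 * dist y z" for y z
  proof (rule dist_bound)
    fix x
    let ?D = "dist y z" and ?e = "exp (- (l * (c x - \<alpha>)))"
    have "\<bar>integral {\<alpha>..c x} (\<lambda>t. h (apply_bcontfun y) t - h (apply_bcontfun z) t)\<bar>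
        \<le> integral {\<alpha>..c x} (\<lambda>t. L * ?D * exp (l * (t - \<alpha>)))"
      unfolding real_norm_def[symmetric]
    proof (rule integral_norm_bound_integral)
      fix t
      have "norm (h (apply_bcontfun y) t - h (apply_bcontfun z) t)
          \<le> L * \<bar>exp (l * (t - \<alpha>)) * apply_bcontfun y t - exp (l * (t - \<alpha>)) * apply_bcontfun z t\<bar>"
        unfolding h_def using lip by simp
      also have "\<dots> = L * (exp (l * (t - \<alpha>)) * dist (apply_bcontfun y t) (apply_bcontfun z t))"
        by (simp add: dist_real_def abs_mult flip: right_diff_distrib)
      also have "\<dots> \<le> L * (exp (l * (t - \<alpha>)) * ?D)"
        using L dist_bounded by (intro mult_left_mono) auto
      finally show "norm (h (apply_bcontfun y) t - h (apply_bcontfun z) t) \<le> L * ?D * exp (l * (t - \<alpha>))"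
        by (simp add: algebra_simps)
    qed (auto intro!: integrable_diff hi integrable_continuous_real hc continuous_intros)
    also have "\<dots> = ?D / 2 * exp (l * (c x - \<alpha>)) - ?D / 2"
    proof -
      have "((\<lambda>t. L * ?D * exp (l * (t - \<alpha>))) has_integral
          (?D / 2 * exp (l * (c x - \<alpha>)) - ?D / 2 * exp (l * (\<alpha> - \<alpha>)))) {\<alpha>..c x}"
      proof (rule fundamental_theorem_of_calculus)
        show "\<alpha> \<le> c x" using cr by auto
        fix t
        have "((\<lambda>t. ?D / 2 * exp (l * (t - \<alpha>))) has_real_derivative L * ?D * exp (l * (t - \<alpha>)))
          (at t within {\<alpha>..c x})"
          unfolding l_def by (auto intro!: derivative_eq_intros)
        then show "((\<lambda>t. ?D / 2 * exp (l * (t - \<alpha>))) has_vector_derivative L * ?D * exp (l * (t - \<alpha>)))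
          (at t within {\<alpha>..c x})"
          by (simp add: has_real_derivative_iff_has_vector_derivative)
      qed
      from integral_unique[OF this] show ?thesis by simp
    qed
    also have "\<dots> \<le> ?D / 2 * exp (l * (c x - \<alpha>))" by simp
    finally have I: "\<bar>integral {\<alpha>..c x} (h (apply_bcontfun y)) - integral {\<alpha>..c x} (h (apply_bcontfun z))\<bar>
        \<le> ?D / 2 * exp (l * (c x - \<alpha>))"
      by (simp add: integral_diff hi)
    have "dist (apply_bcontfun (F y) x) (apply_bcontfun (F z) x)
       = ?e * \<bar>integral {\<alpha>..c x} (h (apply_bcontfun y)) - integral {\<alpha>..c x} (h (apply_bcontfun z))\<bar>"
      by (simp add: F T_def dist_real_def abs_mult flip: right_diff_distrib)
    also have "\<dots> \<le> ?e * (?D / 2 * exp (l * (c x - \<alpha>)))" by (intro mult_left_mono I) simp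
    also have "\<dots> = ?D / 2" by (simp add: exp_minus)
    finally show "dist (apply_bcontfun (F y) x) (apply_bcontfun (F z) x) \<le> 1 / 2 * ?D" by simp
  qed
  then have "\<exists>!y. F y = y" by (intro banach_fix_type[of "1/2"]) auto
  then obtain y where y: "F y = y" by blast
  define u where "u x = \<xi> + integral {\<alpha>..x} (h (apply_bcontfun y))" for x
  have yu: "exp (l * (x - \<alpha>)) * apply_bcontfun y x = u x" if "x \<in> {\<alpha>..\<beta>}" for x
  proof -
    have "c x = x" using that by (auto simp: c_def)
    then have "apply_bcontfun y x = exp (- (l * (x - \<alpha>))) * u x"
      using arg_cong[OF y, of "\<lambda>f. apply_bcontfun f x"] by (simp add: F T_def u_def)
    then show ?thesis by (simp add: exp_minus)
  qed
  show thesis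
  proof
    show "u \<alpha> = \<xi>" by (simp add: u_def)
    fix x assume x: "x \<in> {\<alpha>..\<beta>}"
    have "(u has_real_derivative h (apply_bcontfun y) x) (at x within {\<alpha>..\<beta>})"
      unfolding u_def by (auto intro!: derivative_eq_intros integral_has_real_derivative[OF hc x])
    then show "(u has_real_derivative g x (u x)) (at x within {\<alpha>..\<beta>})"
      by (simp add: h_def yu[OF x])
  qed
qed

section \<open>The Pruefer equation on an interval\<close>


lemma sin_squared_lipschitz: "\<bar>(sin y)\<^sup>2 - (sin z)\<^sup>2\<bar> \<le> \<bar>y - z\<bar>" for y z :: real
proof -
  have "sin (y + z) * sin (y - z) = (sin y)\<^sup>2 * (cos z)\<^sup>2 - (cos y)\<^sup>2 * (sin z)\<^sup>2"
    by (simp add: sin_add sin_diff power2_eq_square algebra_simps)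
  then have "(sin y)\<^sup>2 - (sin z)\<^sup>2 = sin (y + z) * sin (y - z)"
    unfolding cos_squared_eq by (simp add: algebra_simps)
  then have "\<bar>(sin y)\<^sup>2 - (sin z)\<^sup>2\<bar> = \<bar>sin (y + z)\<bar> * \<bar>sin (y - z)\<bar>" by (simp add: abs_mult)
  also have "\<dots> \<le> 1 * \<bar>y - z\<bar>" by (intro mult_mono abs_sin_le_one abs_sin_x_le_abs_x) auto
  finally show ?thesis by simp
qed

text \<open>
  Because \<open>cos\<^sup>2 = 1 - sin\<^sup>2\<close>, only the increments of \<open>sin\<^sup>2\<close> matter, and \<open>sin\<^sup>2\<close> is 1-Lipschitz.
\<close>

lemma pruefer_field_lipschitz:
  fixes A b b' y z :: real
  shows "\<bar>(A * (cos y)\<^sup>2 - b * (sin y)\<^sup>2) - (A * (cos z)\<^sup>2 - b' * (sin z)\<^sup>2)\<bar>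
    \<le> (\<bar>A\<bar> + \<bar>b\<bar>) * \<bar>y - z\<bar> + \<bar>b - b'\<bar>"
proof -
  have "(A * (cos y)\<^sup>2 - b * (sin y)\<^sup>2) - (A * (cos z)\<^sup>2 - b' * (sin z)\<^sup>2)
      = - ((A + b) * ((sin y)\<^sup>2 - (sin z)\<^sup>2)) - (b - b') * (sin z)\<^sup>2"
    by (simp add: cos_squared_eq algebra_simps)
  also have "\<bar>\<dots>\<bar> \<le> \<bar>A + b\<bar> * \<bar>(sin y)\<^sup>2 - (sin z)\<^sup>2\<bar> + \<bar>b - b'\<bar> * \<bar>(sin z)\<^sup>2\<bar>"
    using abs_triangle_ineq4[of "- ((A + b) * ((sin y)\<^sup>2 - (sin z)\<^sup>2))" "(b - b') * (sin z)\<^sup>2"]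
    by (simp only: abs_minus_cancel abs_mult)
  also have "\<dots> \<le> (\<bar>A\<bar> + \<bar>b\<bar>) * \<bar>y - z\<bar> + \<bar>b - b'\<bar> * 1"
    by (intro add_mono mult_mono sin_squared_lipschitz abs_triangle_ineq)
       (auto simp: abs_square_le_1)
  finally show ?thesis by simp
qed

lemma pruefer_field_bound: "\<bar>A * (cos y)\<^sup>2 - b * (sin y)\<^sup>2\<bar> \<le> \<bar>A\<bar> + \<bar>b\<bar>" for A b y :: real
proof -
  have "\<bar>A * (cos y)\<^sup>2 - b * (sin y)\<^sup>2\<bar> \<le> \<bar>A\<bar> * \<bar>(cos y)\<^sup>2\<bar> + \<bar>b\<bar> * \<bar>(sin y)\<^sup>2\<bar>"
    using abs_triangle_ineq4[of "A * (cos y)\<^sup>2" "b * (sin y)\<^sup>2"] by (simp only: abs_mult)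
  also have "\<dots> \<le> \<bar>A\<bar> * 1 + \<bar>b\<bar> * 1"
    by (intro add_mono mult_left_mono) (auto simp: abs_square_le_1)
  finally show ?thesis by simp
qed

lemma pruefer_arc_subinterval:
  assumes "pruefer_arc A b \<alpha> \<beta> u" "\<alpha> \<le> \<gamma>" "\<delta> \<le> \<beta>"
  shows "pruefer_arc A b \<gamma> \<delta> u"
  using assms unfolding pruefer_arc_def by (auto intro: continuous_on_subset)

lemma pruefer_arc_translate:
  assumes "pruefer_arc A b \<alpha> \<beta> u"
  shows "pruefer_arc A (\<lambda>x. b (x + h)) (\<alpha> - h) (\<beta> - h) (\<lambda>x. u (x + h))"
  unfolding pruefer_arc_def
proof (intro conjI ballI)
  show "continuous_on {\<alpha> - h..\<beta> - h} (\<lambda>x. u (x + h))"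
    by (rule continuous_on_compose2[of "{\<alpha>..\<beta>}" u])
       (use assms in \<open>auto simp: pruefer_arc_def intro!: continuous_intros\<close>)
  fix x assume "x \<in> {\<alpha> - h<..<\<beta> - h}"
  then have "x + h \<in> {\<alpha><..<\<beta>}" by auto
  with assms have "(u has_real_derivative A * (cos (u (x + h)))\<^sup>2 - b (x + h) * (sin (u (x + h)))\<^sup>2) (at (x + h))"
    unfolding pruefer_arc_def by blast
  then show "((\<lambda>x. u (x + h)) has_real_derivative
      A * (cos (u (x + h)))\<^sup>2 - b (x + h) * (sin (u (x + h)))\<^sup>2) (at x)"
    by (simp add: DERIV_shift)
qed

lemma pruefer_arc_add_pi:
  assumes "pruefer_arc A b \<alpha> \<beta> u"
  shows "pruefer_arc A b \<alpha> \<beta> (\<lambda>x. u x + pi)"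
  using assms unfolding pruefer_arc_def
  by (auto intro!: continuous_intros derivative_eq_intros)

lemma pruefer_arc_speed:
  assumes u: "pruefer_arc A b \<alpha> \<beta> u" and b: "\<And>x. \<alpha> < x \<Longrightarrow> x < \<beta> \<Longrightarrow> \<bar>b x\<bar> \<le> K"
    and xy: "\<alpha> \<le> x" "x \<le> y" "y \<le> \<beta>"
  shows "\<bar>u y - u x\<bar> \<le> (\<bar>A\<bar> + K) * (y - x)"
proof (cases "x = y")
  case False
  then have "x < y" using xy by simp
  moreover have "continuous_on {x..y} u"
    using u xy by (auto simp: pruefer_arc_def intro: continuous_on_subset)
  moreover have D: "(u has_real_derivative A * (cos (u z))\<^sup>2 - b z * (sin (u z))\<^sup>2) (at z)"
    if "x < z" "z < y" for z
    using u xy that by (auto simp: pruefer_arc_def)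
  ultimately obtain l z where z: "x < z" "z < y" "(u has_real_derivative l) (at z)"
      "u y - u x = (y - x) * l"
    using MVT[of x y u] by (meson real_differentiable_def)
  have "l = A * (cos (u z))\<^sup>2 - b z * (sin (u z))\<^sup>2" using DERIV_unique[OF z(3) D[OF z(1,2)]] .
  then have "\<bar>l\<bar> \<le> \<bar>A\<bar> + K" using pruefer_field_bound[of A "u z" "b z"] b[of z] z xy by simp
  then show ?thesis using z(4) \<open>x < y\<close> by (simp add: abs_mult mult.commute mult_right_mono)
qed simp

text \<open>
  Gronwall for the difference of two solutions with different coefficients, in both directions. All
  uniqueness, Lipschitz and perturbation statements below are instances.
\<close>

lemma pruefer_arc_comparison:
  assumes ab: "\<alpha> \<le> \<beta>"
    and u: "pruefer_arc A b \<alpha> \<beta> u" and v: "pruefer_arc A b' \<alpha> \<beta> v"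
    and K: "\<And>x. \<alpha> < x \<Longrightarrow> x < \<beta> \<Longrightarrow> \<bar>b x\<bar> \<le> K" "0 \<le> K"
    and e: "\<And>x. \<alpha> < x \<Longrightarrow> x < \<beta> \<Longrightarrow> \<bar>b x - b' x\<bar> \<le> e" "0 \<le> e"
  shows "\<bar>u \<beta> - v \<beta>\<bar> \<le> exp ((2 * (\<bar>A\<bar> + K) + 1) * (\<beta> - \<alpha>)) * (\<bar>u \<alpha> - v \<alpha>\<bar> + e * (1 + (\<beta> - \<alpha>)))"
    and "\<bar>u \<alpha> - v \<alpha>\<bar> \<le> exp ((2 * (\<bar>A\<bar> + K) + 1) * (\<beta> - \<alpha>)) * (\<bar>u \<beta> - v \<beta>\<bar> + e * (1 + (\<beta> - \<alpha>)))"
proof -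
  define w' where "w' x = (A * (cos (u x))\<^sup>2 - b x * (sin (u x))\<^sup>2) - (A * (cos (v x))\<^sup>2 - b' x * (sin (v x))\<^sup>2)" for x
  have cont: "continuous_on {\<alpha>..\<beta>} (\<lambda>x. u x - v x)"
    using u v by (auto simp: pruefer_arc_def intro!: continuous_intros)
  have der: "((\<lambda>x. u x - v x) has_real_derivative w' x) (at x)" if "\<alpha> < x" "x < \<beta>" for x
    unfolding w'_def using u v that by (auto simp: pruefer_arc_def intro!: DERIV_diff)
  have bnd: "\<bar>w' x\<bar> \<le> (\<bar>A\<bar> + K) * \<bar>u x - v x\<bar> + e" if x: "\<alpha> < x" "x < \<beta>" for x
  proof -
    have "\<bar>w' x\<bar> \<le> (\<bar>A\<bar> + \<bar>b x\<bar>) * \<bar>u x - v x\<bar> + \<bar>b x - b' x\<bar>"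
      unfolding w'_def by (rule pruefer_field_lipschitz)
    also have "\<dots> \<le> (\<bar>A\<bar> + K) * \<bar>u x - v x\<bar> + e"
      using K(1)[OF x] e(1)[OF x] by (intro add_mono mult_right_mono) auto
    finally show ?thesis .
  qed
  show "\<bar>u \<beta> - v \<beta>\<bar> \<le> exp ((2 * (\<bar>A\<bar> + K) + 1) * (\<beta> - \<alpha>)) * (\<bar>u \<alpha> - v \<alpha>\<bar> + e * (1 + (\<beta> - \<alpha>)))"
    using gronwall[OF ab _ e(2) cont der bnd] K(2) by simp
  show "\<bar>u \<alpha> - v \<alpha>\<bar> \<le> exp ((2 * (\<bar>A\<bar> + K) + 1) * (\<beta> - \<alpha>)) * (\<bar>u \<beta> - v \<beta>\<bar> + e * (1 + (\<beta> - \<alpha>)))"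
    using gronwall_backward[OF ab _ e(2) cont der bnd] K(2) by simp
qed

text \<open>
  The flow map of the Pruefer equation from \<open>\<alpha>\<close> to \<open>\<beta>\<close>.
\<close>

definition transport :: "real \<Rightarrow> (real \<Rightarrow> real) \<Rightarrow> real \<Rightarrow> real \<Rightarrow> real \<Rightarrow> real" where
  "transport A b \<alpha> \<beta> \<xi> = (THE y. \<exists>u. pruefer_arc A b \<alpha> \<beta> u \<and> u \<alpha> = \<xi> \<and> u \<beta> = y)"

locale pruefer_interval =
  fixes A :: real and b :: "real \<Rightarrow> real" and \<alpha> \<beta> K :: real
  assumes less: "\<alpha> < \<beta>"
    and unif: "uniformly_continuous_on {\<alpha><..<\<beta>} b"
    and bound: "\<And>x. \<alpha> < x \<Longrightarrow> x < \<beta> \<Longrightarrow> \<bar>b x\<bar> \<le> K"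
    and K_nonneg: "0 \<le> K"
begin

text \<open>
  A uniformly continuous coefficient on the open interval extends continuously to its closure, and from
  there, constantly, to the line.
\<close>

lemma arc_exists: "\<exists>u. pruefer_arc A b \<alpha> \<beta> u \<and> u \<alpha> = \<xi>"
proof -
  have cl: "closure {\<alpha><..<\<beta>} = {\<alpha>..\<beta>}" using less by simp
  obtain g where g: "uniformly_continuous_on {\<alpha>..\<beta>} g" "\<And>x. x \<in> {\<alpha><..<\<beta>} \<Longrightarrow> b x = g x"
    by (rule uniformly_continuous_on_extension_on_closure[OF unif]) (simp add: cl)
  have gc: "continuous_on {\<alpha>..\<beta>} g" using g(1) by (rule uniformly_continuous_imp_continuous)
  have "bounded (g ` {\<alpha>..\<beta>})"
    by (intro compact_imp_bounded compact_continuous_image gc) auto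
  then obtain B where B: "\<forall>x\<in>{\<alpha>..\<beta>}. norm (g x) \<le> B" by (auto simp: bounded_iff)
  define c where "c x = max \<alpha> (min \<beta> x)" for x
  have c: "c x \<in> {\<alpha>..\<beta>}" for x using less by (auto simp: c_def)
  have cg: "continuous_on UNIV (\<lambda>z::real \<times> real. g (c (fst z)))"
    by (rule continuous_on_compose2[OF gc]) (use c in \<open>auto simp: c_def intro!: continuous_intros\<close>)
  define F where "F x y = A * (cos y)\<^sup>2 - g (c x) * (sin y)\<^sup>2" for x y
  have Fc: "continuous_on UNIV (\<lambda>z. F (fst z) (snd z))"
    unfolding F_def by (intro continuous_intros cg)
  have Fl: "\<bar>F x y - F x z\<bar> \<le> (\<bar>A\<bar> + \<bar>B\<bar> + 1) * \<bar>y - z\<bar>" for x y z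
  proof -
    have "\<bar>F x y - F x z\<bar> \<le> (\<bar>A\<bar> + \<bar>g (c x)\<bar>) * \<bar>y - z\<bar>"
      unfolding F_def using pruefer_field_lipschitz[of A y "g (c x)" z "g (c x)"] by simp
    also have "\<dots> \<le> (\<bar>A\<bar> + \<bar>B\<bar> + 1) * \<bar>y - z\<bar>"
      using B c[of x] by (intro mult_right_mono) force+
    finally show ?thesis .
  qed
  have L: "0 < \<bar>A\<bar> + \<bar>B\<bar> + 1" by simp
  obtain u where u: "u \<alpha> = \<xi>"
      "\<And>x. x \<in> {\<alpha>..\<beta>} \<Longrightarrow> (u has_real_derivative F x (u x)) (at x within {\<alpha>..\<beta>})"
    by (rule picard[OF less_imp_le[OF less] L Fc Fl, where \<xi> = \<xi>]) (rule that, assumption, blast)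
  have "continuous_on {\<alpha>..\<beta>} u"
    by (rule DERIV_continuous_on[OF u(2)])
  moreover have "(u has_real_derivative A * (cos (u x))\<^sup>2 - b x * (sin (u x))\<^sup>2) (at x)"
    if x: "x \<in> {\<alpha><..<\<beta>}" for x
  proof -
    have "c x = x" using x by (auto simp: c_def)
    then have "F x (u x) = A * (cos (u x))\<^sup>2 - b x * (sin (u x))\<^sup>2" using g(2)[OF x] by (simp add: F_def)
    moreover have "at x within {\<alpha>..\<beta>} = at x"
      using x by (intro at_within_interior) auto
    ultimately show ?thesis using u(2)[of x] x by simp
  qed
  ultimately show ?thesis using u(1) unfolding pruefer_arc_def by blast
qed

definition "growth = exp ((2 * (\<bar>A\<bar> + K) + 1) * (\<beta> - \<alpha>))"

lemma arcs_diverge: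
  assumes "pruefer_arc A b \<alpha> \<beta> u" "pruefer_arc A b \<alpha> \<beta> v"
    and "\<alpha> \<le> \<gamma>" "\<gamma> \<le> \<delta>" "\<delta> \<le> \<beta>"
  shows "\<bar>u \<delta> - v \<delta>\<bar> \<le> growth * \<bar>u \<gamma> - v \<gamma>\<bar>" "\<bar>u \<gamma> - v \<gamma>\<bar> \<le> growth * \<bar>u \<delta> - v \<delta>\<bar>"
proof -
  have le: "exp ((2 * (\<bar>A\<bar> + K) + 1) * (\<delta> - \<gamma>)) \<le> growth"
    unfolding growth_def using assms K_nonneg by (auto intro!: mult_left_mono)
  have *: "pruefer_arc A b \<gamma> \<delta> u" "pruefer_arc A b \<gamma> \<delta> v"
    using assms pruefer_arc_subinterval by blast+
  have bd: "\<bar>b x\<bar> \<le> K" if "\<gamma> < x" "x < \<delta>" for x using bound[of x] that assms by simp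
  have ze: "\<bar>b x - b x\<bar> \<le> 0" for x by simp
  note c = pruefer_arc_comparison[OF assms(4) * bd K_nonneg ze order_refl]
  have "\<bar>u \<delta> - v \<delta>\<bar> \<le> exp ((2 * (\<bar>A\<bar> + K) + 1) * (\<delta> - \<gamma>)) * \<bar>u \<gamma> - v \<gamma>\<bar>"
    using c(1) by simp
  also have "\<dots> \<le> growth * \<bar>u \<gamma> - v \<gamma>\<bar>" by (intro mult_right_mono le) simp
  finally show "\<bar>u \<delta> - v \<delta>\<bar> \<le> growth * \<bar>u \<gamma> - v \<gamma>\<bar>" .
  have "\<bar>u \<gamma> - v \<gamma>\<bar> \<le> exp ((2 * (\<bar>A\<bar> + K) + 1) * (\<delta> - \<gamma>)) * \<bar>u \<delta> - v \<delta>\<bar>"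
    using c(2) by simp
  also have "\<dots> \<le> growth * \<bar>u \<delta> - v \<delta>\<bar>" by (intro mult_right_mono le) simp
  finally show "\<bar>u \<gamma> - v \<gamma>\<bar> \<le> growth * \<bar>u \<delta> - v \<delta>\<bar>" .
qed

lemma arc_unique:
  assumes "pruefer_arc A b \<alpha> \<beta> u" "pruefer_arc A b \<alpha> \<beta> v" "u \<alpha> = v \<alpha>" "\<alpha> \<le> x" "x \<le> \<beta>"
  shows "u x = v x"
  using arcs_diverge(1)[OF assms(1,2), of \<alpha> x] assms by simp

lemma transport_arc:
  assumes "pruefer_arc A b \<alpha> \<beta> u"
  shows "transport A b \<alpha> \<beta> (u \<alpha>) = u \<beta>"
  unfolding transport_def
proof (rule the_equality)
  show "\<exists>v. pruefer_arc A b \<alpha> \<beta> v \<and> v \<alpha> = u \<alpha> \<and> v \<beta> = u \<beta>" using assms by blast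
  fix y assume "\<exists>v. pruefer_arc A b \<alpha> \<beta> v \<and> v \<alpha> = u \<alpha> \<and> v \<beta> = y"
  then obtain v where "pruefer_arc A b \<alpha> \<beta> v" "v \<alpha> = u \<alpha>" "v \<beta> = y" by blast
  with arc_unique[OF this(1) assms this(2), of \<beta>] less show "y = u \<beta>" by simp
qed

lemma transport_arcE:
  obtains u where "pruefer_arc A b \<alpha> \<beta> u" "u \<alpha> = \<xi>" "transport A b \<alpha> \<beta> \<xi> = u \<beta>"
proof -
  obtain u where "pruefer_arc A b \<alpha> \<beta> u" "u \<alpha> = \<xi>" using arc_exists[of \<xi>] by (elim exE conjE)
  with transport_arc[OF this(1)] show thesis by (intro that[of u]) simp_all
qed

lemma transport_lipschitz: "\<bar>transport A b \<alpha> \<beta> \<xi> - transport A b \<alpha> \<beta> \<eta>\<bar> \<le> growth * \<bar>\<xi> - \<eta>\<bar>"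
proof -
  obtain u where u: "pruefer_arc A b \<alpha> \<beta> u" "u \<alpha> = \<xi>" "transport A b \<alpha> \<beta> \<xi> = u \<beta>"
    by (rule transport_arcE)
  obtain v where v: "pruefer_arc A b \<alpha> \<beta> v" "v \<alpha> = \<eta>" "transport A b \<alpha> \<beta> \<eta> = v \<beta>"
    by (rule transport_arcE)
  show ?thesis using arcs_diverge(1)[OF u(1) v(1) order_refl less_imp_le[OF less] order_refl]
    unfolding u(2,3) v(2,3) .
qed

lemma transport_inj:
  assumes "transport A b \<alpha> \<beta> \<xi> = transport A b \<alpha> \<beta> \<eta>" shows "\<xi> = \<eta>"
proof -
  obtain u where u: "pruefer_arc A b \<alpha> \<beta> u" "u \<alpha> = \<xi>" "transport A b \<alpha> \<beta> \<xi> = u \<beta>"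
    by (rule transport_arcE)
  obtain v where v: "pruefer_arc A b \<alpha> \<beta> v" "v \<alpha> = \<eta>" "transport A b \<alpha> \<beta> \<eta> = v \<beta>"
    by (rule transport_arcE)
  show ?thesis using arcs_diverge(2)[OF u(1) v(1) order_refl less_imp_le[OF less] order_refl]
      assms unfolding u(2,3) v(2,3) by simp
qed

lemma transport_displacement: "\<bar>transport A b \<alpha> \<beta> \<xi> - \<xi>\<bar> \<le> (\<bar>A\<bar> + K) * (\<beta> - \<alpha>)"
proof -
  obtain u where "pruefer_arc A b \<alpha> \<beta> u" "u \<alpha> = \<xi>" "transport A b \<alpha> \<beta> \<xi> = u \<beta>"
    by (rule transport_arcE)
  then show ?thesis using pruefer_arc_speed[of A b \<alpha> \<beta> u K \<alpha> \<beta>] bound less by auto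
qed

lemma transport_add_pi: "transport A b \<alpha> \<beta> (\<xi> + pi) = transport A b \<alpha> \<beta> \<xi> + pi"
proof -
  obtain u where u: "pruefer_arc A b \<alpha> \<beta> u" "u \<alpha> = \<xi>" "transport A b \<alpha> \<beta> \<xi> = u \<beta>"
    by (rule transport_arcE)
  show ?thesis using transport_arc[OF pruefer_arc_add_pi[OF u(1)]] u by simp
qed

text \<open>
  Two solutions cannot change order: by continuity they would meet, and after a meeting point they
  coincide.
\<close>

lemma transport_mono:
  assumes "\<xi> \<le> \<eta>" shows "transport A b \<alpha> \<beta> \<xi> \<le> transport A b \<alpha> \<beta> \<eta>"
proof (rule ccontr)
  assume gt: "\<not> ?thesis"
  obtain u where u: "pruefer_arc A b \<alpha> \<beta> u" "u \<alpha> = \<xi>" "transport A b \<alpha> \<beta> \<xi> = u \<beta>"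
    by (rule transport_arcE)
  obtain v where v: "pruefer_arc A b \<alpha> \<beta> v" "v \<alpha> = \<eta>" "transport A b \<alpha> \<beta> \<eta> = v \<beta>"
    by (rule transport_arcE)
  note * = u v
  have "continuous_on {\<alpha>..\<beta>} (\<lambda>x. u x - v x)"
    using * by (auto simp: pruefer_arc_def intro!: continuous_intros)
  then obtain s where "\<alpha> \<le> s" "s \<le> \<beta>" "u s - v s = 0"
    using IVT'[of "\<lambda>x. u x - v x" \<alpha> 0 \<beta>] * assms gt less by auto
  then show False using arcs_diverge(1)[OF *(1,4), of s \<beta>] * gt by auto
qed

end

section \<open>Means of almost periodic quasi-additive cocycles\<close>


text \<open>
  \<open>D N t\<close> stands for the displacement produced by \<open>N\<close> steps that begin at time \<open>t\<close>.
\<close>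

definition quasi_cocycle :: "real \<Rightarrow> (nat \<Rightarrow> int \<Rightarrow> real) \<Rightarrow> bool" where
  "quasi_cocycle c D \<longleftrightarrow> (\<forall>N L t. \<bar>D (N + L) t - D N t - D L (t + int N)\<bar> \<le> c)"

lemma quasi_cocycle_sum:
  assumes "quasi_cocycle c D" "1 \<le> k"
  shows "\<bar>D (k * N) t - (\<Sum>j<k. D N (t + int (j * N)))\<bar> \<le> c * (real k - 1)"
  using assms(2)
proof (induction k rule: dec_induct)
  case base then show ?case by simp
next
  case (step k)
  have "\<bar>D (k * N + N) t - D (k * N) t - D N (t + int (k * N))\<bar> \<le> c"
    using assms(1) unfolding quasi_cocycle_def by blast
  with step.IH show ?case by (simp add: algebra_simps)
qed

lemma quasi_cocycle_bound:
  assumes D: "quasi_cocycle c D" and B: "\<And>t. \<bar>D 1 t\<bar> \<le> B"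
  shows "\<bar>D n t\<bar> \<le> c + (B + c) * real n"
proof (cases "n = 0")
  case True
  have "\<bar>D (0 + 0) t - D 0 t - D 0 (t + int 0)\<bar> \<le> c" using D unfolding quasi_cocycle_def by blast
  with True show ?thesis by simp
next
  case False
  have c: "0 \<le> c" using D abs_ge_zero order_trans unfolding quasi_cocycle_def by blast
  have "\<bar>\<Sum>j<n. D 1 (t + int (j * 1))\<bar> \<le> (\<Sum>j<n. \<bar>D 1 (t + int (j * 1))\<bar>)" by (rule sum_abs)
  also have "\<dots> \<le> B * real n" using sum_bounded_above[of "{..<n}" "\<lambda>j. \<bar>D 1 (t + int (j * 1))\<bar>" B] B
    by (simp add: mult.commute)
  finally have "\<bar>\<Sum>j<n. D 1 (t + int (j * 1))\<bar> \<le> B * real n" .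
  moreover have "\<bar>D n t - (\<Sum>j<n. D 1 (t + int (j * 1)))\<bar> \<le> c * (real n - 1)"
    using quasi_cocycle_sum[OF D, of n 1 t] False by simp
  ultimately show ?thesis using c by (simp add: algebra_simps)
qed

text \<open>
  An almost period \<open>s\<close> of \<open>D N\<close> lying within \<open>S\<close> of \<open>a\<close> serves as intermediate base point. From 0 to \<open>s\<close> the
  \<open>n / N\<close> blocks of length \<open>N\<close> change by at most \<open>c\<close> each, and cutting both displacements into blocks
  costs another \<open>2 c\<close> per block; from \<open>s\<close> to \<open>a\<close> only boundary terms of size \<open>O(S)\<close> arise. Since \<open>N\<close>
  is arbitrary, the linear term can be given any slope.
\<close>

lemma quasi_cocycle_base_point:
  assumes D: "quasi_cocycle c D" and B: "\<And>t. \<bar>D 1 t\<bar> \<le> B"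
    and ap: "\<And>N. \<exists>S. \<forall>a. \<exists>s. \<bar>s - a\<bar> \<le> S \<and> (\<forall>t. \<bar>D N (t + s) - D N t\<bar> \<le> c)"
    and N: "1 \<le> N"
  shows "\<exists>C. \<forall>n a. \<bar>D n a - D n 0\<bar> \<le> 3 * c / real N * real n + C"
proof -
  have c: "0 \<le> c" using D abs_ge_zero order_trans unfolding quasi_cocycle_def by blast
  have B0: "0 \<le> B" using B[of 0] by linarith
  have split: "\<bar>D (N + L) t - D N t - D L (t + int N)\<bar> \<le> c" for N L t
    using D unfolding quasi_cocycle_def by blast
  have bd: "\<bar>D n t\<bar> \<le> c + (B + c) * real n" for n t by (rule quasi_cocycle_bound[OF D B])
  obtain S where S: "\<forall>a. \<exists>s. \<bar>s - a\<bar> \<le> S \<and> (\<forall>t. \<bar>D N (t + s) - D N t\<bar> \<le> c)" using ap by blast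
  have S0: "0 \<le> S" using S abs_ge_zero order_trans by blast
  \<comment> \<open>both splittings of \<open>D (l + n) t\<close>, the block of length \<open>l\<close> coming first or last\<close>
  have move: "\<bar>D n (t + int l) - D n t\<bar> \<le> 2 * c + 2 * (c + (B + c) * real l)" for n t l
    using split[of l n t] split[of n l t] bd[of l t] bd[of l "t + int n"]
    by (simp add: add.commute)
  have move': "\<bar>D n a - D n s\<bar> \<le> 4 * c + 2 * (B + c) * real_of_int S" if "\<bar>s - a\<bar> \<le> S" for n a s
  proof (cases "s \<le> a")
    case True
    then have "a = s + int (nat (a - s))" by simp
    moreover have "2 * c + 2 * (c + (B + c) * real (nat (a - s))) \<le> 4 * c + 2 * (B + c) * real_of_int S"
      using True that B0 c mult_left_mono[of "real_of_int (a - s)" S "B + c"] by (simp add: algebra_simps)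
    ultimately show ?thesis using move[of n s "nat (a - s)"] by simp
  next
    case False
    then have "s = a + int (nat (s - a))" by simp
    moreover have "2 * c + 2 * (c + (B + c) * real (nat (s - a))) \<le> 4 * c + 2 * (B + c) * real_of_int S"
      using False that B0 c mult_left_mono[of "real_of_int (s - a)" S "B + c"] by (simp add: algebra_simps)
    ultimately show ?thesis using move[of n a "nat (s - a)"] by (simp add: abs_minus_commute)
  qed
  define R where "R = c + (B + c) * real N"
  have "\<bar>D n a - D n 0\<bar> \<le> 3 * c / real N * real n + (8 * c + 2 * (B + c) * real_of_int S + 2 * R)" for n a
  proof -
    obtain s where s: "\<bar>s - a\<bar> \<le> S" "\<And>t. \<bar>D N (t + s) - D N t\<bar> \<le> c" using S by blast
    define k where "k = n div N"
    have n: "n = k * N + n mod N" by (simp add: k_def)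
    have blocks: "\<bar>D (k * N) s - D (k * N) 0\<bar> \<le> 3 * c * real k + 2 * c"
    proof (cases "k = 0")
      case True
      then show ?thesis using bd[of 0 s] bd[of 0 0] c by simp
    next
      case False
      have "\<bar>(\<Sum>j<k. D N (s + int (j * N))) - (\<Sum>j<k. D N (0 + int (j * N)))\<bar>
          \<le> (\<Sum>j<k. \<bar>D N (s + int (j * N)) - D N (0 + int (j * N))\<bar>)"
        unfolding sum_subtractf[symmetric] by (rule sum_abs)
      also have "\<dots> \<le> c * real k"
        using sum_bounded_above[of "{..<k}" "\<lambda>j. \<bar>D N (s + int (j * N)) - D N (0 + int (j * N))\<bar>" c]
          s(2)[of "int (_ * N)"] by (simp add: add.commute mult.commute)
      finally show ?thesis
        using quasi_cocycle_sum[OF D, of k N s] quasi_cocycle_sum[OF D, of k N 0] False c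
        by (simp add: algebra_simps)
    qed
    have rest: "\<bar>D (n mod N) t\<bar> \<le> R" for t
    proof -
      have "(B + c) * real (n mod N) \<le> (B + c) * real N"
        using N B0 c by (intro mult_left_mono) (auto intro: less_imp_le)
      then show ?thesis using bd[of "n mod N" t] by (simp add: R_def)
    qed
    have kn: "3 * c * real k \<le> 3 * c / real N * real n"
    proof -
      have "real k * real N \<le> real n" using n by (metis le_add1 of_nat_le_iff of_nat_mult)
      then have "real k \<le> real n / real N" using N by (simp add: field_simps)
      from mult_left_mono[OF this, of "3 * c"] c show ?thesis by simp
    qed
    have "\<bar>D n s - D n 0\<bar> \<le> 3 * c * real k + 2 * c + 2 * c + 2 * R"
      using split[of "k * N" "n mod N" s] split[of "k * N" "n mod N" 0] blocks
        rest[of "s + int (k * N)"] rest[of "0 + int (k * N)"] n by simp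
    then show ?thesis using move'[OF s(1), of n] kn c by linarith
  qed
  then show ?thesis by blast
qed


text \<open>
  By the previous lemma all blocks of length \<open>n\<close> have nearly the displacement \<open>D n 0\<close>, so
  \<open>D (k n) 0 / (k n)\<close> is close to \<open>D n 0 / n\<close> uniformly in \<open>k\<close>. Comparing \<open>D m 0 / m\<close> and \<open>D n 0 / n\<close> through
  \<open>D (m n) 0 / (m n)\<close> shows that the sequence is Cauchy.
\<close>

lemma quasi_cocycle_convergent:
  assumes D: "quasi_cocycle c D" and B: "\<And>t. \<bar>D 1 t\<bar> \<le> B"
    and ap: "\<And>N. \<exists>S. \<forall>a. \<exists>s. \<bar>s - a\<bar> \<le> S \<and> (\<forall>t. \<bar>D N (t + s) - D N t\<bar> \<le> c)"
  shows "convergent (\<lambda>n. D n 0 / real n)"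
proof -
  have c: "0 \<le> c" using D abs_ge_zero order_trans unfolding quasi_cocycle_def by blast
  have "Cauchy (\<lambda>n. D n 0 / real n)"
  proof (rule CauchyI)
    fix e :: real assume e: "0 < e"
    obtain N :: nat where N: "12 * c / e < real N" using reals_Archimedean2 by blast
    \<comment> \<open>the slope supplied by blocks of length \<open>Suc N\<close>; four times the slope is still below \<open>e\<close>\<close>
    define d where "d = 3 * c / real (Suc N)"
    have d: "4 * d < e"
      using N e by (simp add: d_def field_simps)
    obtain C where C: "\<And>n a. \<bar>D n a - D n 0\<bar> \<le> d * real n + C"
      using quasi_cocycle_base_point[OF D B ap, of "Suc N"] unfolding d_def by auto
    have main: "\<bar>D (k * n) 0 / real (k * n) - D n 0 / real n\<bar> \<le> d + (c + C) / real n"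
      if k: "1 \<le> k" and n: "1 \<le> n" for k n
    proof -
      have "\<bar>(\<Sum>j<k. D n (0 + int (j * n))) - (\<Sum>j<k. D n 0)\<bar>
          \<le> (\<Sum>j<k. \<bar>D n (0 + int (j * n)) - D n 0\<bar>)"
        unfolding sum_subtractf[symmetric] by (rule sum_abs)
      also have "\<dots> \<le> real k * (d * real n + C)"
        using sum_bounded_above[of "{..<k}" "\<lambda>j. \<bar>D n (0 + int (j * n)) - D n 0\<bar>" "d * real n + C"] C
        by simp
      finally have "\<bar>(\<Sum>j<k. D n (0 + int (j * n))) - real k * D n 0\<bar> \<le> real k * (d * real n + C)" by simp
      then have le: "\<bar>D (k * n) 0 - real k * D n 0\<bar> \<le> real k * (d * real n + C + c)"
        using quasi_cocycle_sum[OF D k, of n 0] c by (simp add: algebra_simps)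
      have "D (k * n) 0 / real (k * n) - D n 0 / real n = (D (k * n) 0 - real k * D n 0) / real (k * n)"
        using k n by (simp add: field_simps)
      also have "\<bar>\<dots>\<bar> = \<bar>D (k * n) 0 - real k * D n 0\<bar> / real (k * n)" by simp
      also have "\<dots> \<le> (real k * (d * real n + C + c)) / real (k * n)"
        by (intro divide_right_mono le) simp
      also have "\<dots> = d + (c + C) / real n" using k n by (simp add: field_simps)
      finally show ?thesis .
    qed
    obtain M0 :: nat where M0: "4 * (c + \<bar>C\<bar>) / e < real M0" using reals_Archimedean2 by blast
    have small: "(c + C) / real n < e / 4" if "n \<ge> Suc M0" for n
    proof -
      have "4 * (c + \<bar>C\<bar>) / e < real n" using M0 that by linarith
      then have "4 * (c + \<bar>C\<bar>) < e * real n" using e by (simp add: field_simps)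
      then show ?thesis using that by (simp add: field_simps)
    qed
    have "norm (D m 0 / real m - D n 0 / real n) < e" if m: "m \<ge> Suc M0" and n: "n \<ge> Suc M0" for m n
    proof -
      have "\<bar>D (n * m) 0 / real (n * m) - D m 0 / real m\<bar> \<le> d + (c + C) / real m"
        "\<bar>D (m * n) 0 / real (m * n) - D n 0 / real n\<bar> \<le> d + (c + C) / real n"
        using main m n by simp_all
      then show ?thesis using small[OF m] small[OF n] d
        unfolding mult.commute[of n m] real_norm_def by linarith
    qed
    then show "\<exists>M. \<forall>m\<ge>M. \<forall>n\<ge>M. norm (D m 0 / real m - D n 0 / real n) < e" by blast
  qed
  then show ?thesis by (rule Cauchy_convergent)
qed

text \<open>
  The mean depends on the cocycle through a single block length \<open>N\<close>, up to an error of order \<open>1 / N\<close>;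
  this turns closeness over finitely many steps into closeness of the means.
\<close>

lemma quasi_cocycle_mean_close:
  assumes D: "quasi_cocycle c D" and D': "quasi_cocycle c D'" and N: "1 \<le> N"
    and e: "\<And>t. \<bar>D N t - D' N t\<bar> \<le> e"
    and lim: "(\<lambda>n. D n 0 / real n) \<longlonglongrightarrow> x" "(\<lambda>n. D' n 0 / real n) \<longlonglongrightarrow> x'"
  shows "\<bar>x - x'\<bar> \<le> (2 * c + e) / real N"
proof -
  have c: "0 \<le> c" using D abs_ge_zero order_trans unfolding quasi_cocycle_def by blast
  have sm: "strict_mono (\<lambda>k. Suc k * N)" using N by (auto simp: strict_mono_Suc_iff)
  have conv: "(\<lambda>k. \<bar>D (Suc k * N) 0 / real (Suc k * N) - D' (Suc k * N) 0 / real (Suc k * N)\<bar>) \<longlonglongrightarrow> \<bar>x - x'\<bar>"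
    using LIMSEQ_subseq_LIMSEQ[OF lim(1) sm] LIMSEQ_subseq_LIMSEQ[OF lim(2) sm]
    unfolding o_def by (intro tendsto_rabs tendsto_diff)
  have bound: "\<bar>D (k * N) 0 / real (k * N) - D' (k * N) 0 / real (k * N)\<bar> \<le> (2 * c + e) / real N"
    if k: "1 \<le> k" for k
  proof -
    have "\<bar>(\<Sum>j<k. D N (0 + int (j * N))) - (\<Sum>j<k. D' N (0 + int (j * N)))\<bar>
        \<le> (\<Sum>j<k. \<bar>D N (0 + int (j * N)) - D' N (0 + int (j * N))\<bar>)"
      unfolding sum_subtractf[symmetric] by (rule sum_abs)
    also have "\<dots> \<le> real k * e"
      using sum_bounded_above[of "{..<k}" "\<lambda>j. \<bar>D N (0 + int (j * N)) - D' N (0 + int (j * N))\<bar>" e] e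
      by simp
    finally have "\<bar>D (k * N) 0 - D' (k * N) 0\<bar> \<le> real k * (2 * c + e)"
      using quasi_cocycle_sum[OF D k, of N 0] quasi_cocycle_sum[OF D' k, of N 0] c
      by (simp add: algebra_simps)
    then have "\<bar>D (k * N) 0 - D' (k * N) 0\<bar> / real (k * N) \<le> real k * (2 * c + e) / real (k * N)"
      by (rule divide_right_mono) simp
    also have "\<dots> = (2 * c + e) / real N" using k by simp
    finally show ?thesis by (simp flip: diff_divide_distrib)
  qed
  show ?thesis
    by (rule LIMSEQ_le_const2[OF conv]) (intro exI[of _ 0] allI impI bound, simp)
qed

section \<open>Iterates of lifts of circle maps\<close>

primrec iter :: "(int \<Rightarrow> real \<Rightarrow> real) \<Rightarrow> int \<Rightarrow> nat \<Rightarrow> real \<Rightarrow> real" where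
  "iter P t 0 \<xi> = \<xi>"
| "iter P t (Suc n) \<xi> = P (t + int n) (iter P t n \<xi>)"

lemma iter_add: "iter P t (n + l) \<xi> = iter P (t + int n) l (iter P t n \<xi>)"
  by (induction l) (simp_all add: algebra_simps)

lemma iter_perturbation:
  assumes lip: "\<And>i \<xi> \<eta>. \<bar>P i \<xi> - P i \<eta>\<bar> \<le> \<Lambda> * \<bar>\<xi> - \<eta>\<bar>" and L: "1 \<le> \<Lambda>"
    and e: "\<And>i \<xi>. \<bar>P (s + i) \<xi> - P' (t + i) \<xi>\<bar> \<le> e"
  shows "\<bar>iter P s n \<xi> - iter P' t n \<xi>\<bar> \<le> real n * \<Lambda> ^ n * e"
proof (induction n)
  case 0 then show ?case by simp
next
  case (Suc n)
  have e0: "0 \<le> e" using e abs_ge_zero order_trans by blast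
  let ?u = "iter P s n \<xi>" and ?v = "iter P' t n \<xi>"
  have "\<bar>P (s + int n) ?u - P' (t + int n) ?v\<bar>
      \<le> \<bar>P (s + int n) ?u - P (s + int n) ?v\<bar> + \<bar>P (s + int n) ?v - P' (t + int n) ?v\<bar>" by simp
  also have "\<dots> \<le> \<Lambda> * (real n * \<Lambda> ^ n * e) + e"
    using lip[of "s + int n" ?u ?v] e[of "int n" ?v] mult_left_mono[OF Suc.IH, of \<Lambda>] L by linarith
  also have "\<dots> \<le> \<Lambda> * (real n * \<Lambda> ^ n * e) + \<Lambda> ^ Suc n * e"
    using mult_right_mono[OF one_le_power[OF L, of "Suc n"] e0] by simp
  also have "\<dots> = real (Suc n) * \<Lambda> ^ Suc n * e" by (simp add: algebra_simps)
  finally show ?case by simp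
qed

text \<open>
  Increasing maps commuting with the translation by \<open>\<pi>\<close> are the lifts of monotone degree-one maps of the
  circle \<open>\<real> / \<pi>\<int>\<close>, on which the direction of \<open>(\<psi>', \<psi>)\<close> lives.
\<close>

locale circle_lifts =
  fixes P :: "int \<Rightarrow> real \<Rightarrow> real"
  assumes mono: "\<xi> \<le> \<eta> \<Longrightarrow> P i \<xi> \<le> P i \<eta>"
    and add_pi: "P i (\<xi> + pi) = P i \<xi> + pi"
begin

lemma iter_mono: "\<xi> \<le> \<eta> \<Longrightarrow> iter P t n \<xi> \<le> iter P t n \<eta>"
  by (induction n) (auto intro: mono)

lemma iter_add_pi: "iter P t n (\<xi> + pi) = iter P t n \<xi> + pi"
  by (induction n) (auto simp: add_pi)

lemma iter_add_int_pi: "iter P t n (\<xi> + of_int k * pi) = iter P t n \<xi> + of_int k * pi"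
proof (induction k rule: int_induct[where k = 0])
  case (step1 k)
  then show ?case using iter_add_pi[of t n "\<xi> + of_int k * pi"] by (simp add: algebra_simps)
next
  case (step2 k)
  then show ?case using iter_add_pi[of t n "\<xi> + of_int (k - 1) * pi"] by (simp add: algebra_simps)
qed simp

text \<open>
  Moving \<open>\<eta>\<close> by a multiple of \<open>\<pi>\<close> changes nothing, so one may assume \<open>\<eta> \<le> \<xi> \<le> \<eta> + \<pi>\<close>; monotonicity keeps
  the images in this order.
\<close>

lemma iter_displacement: "\<bar>(iter P t n \<xi> - \<xi>) - (iter P t n \<eta> - \<eta>)\<bar> \<le> pi"
proof -
  define k where "k = \<lfloor>(\<xi> - \<eta>) / pi\<rfloor>"
  define \<zeta> where "\<zeta> = \<eta> + of_int k * pi"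
  have "of_int k \<le> (\<xi> - \<eta>) / pi" "(\<xi> - \<eta>) / pi \<le> of_int k + 1" unfolding k_def by linarith+
  then have "\<zeta> \<le> \<xi>" "\<xi> \<le> \<zeta> + pi" by (simp_all add: \<zeta>_def field_simps)
  then have "iter P t n \<zeta> \<le> iter P t n \<xi>" "iter P t n \<xi> \<le> iter P t n \<zeta> + pi"
    using iter_mono iter_add_pi by metis+
  moreover have "iter P t n \<zeta> - \<zeta> = iter P t n \<eta> - \<eta>" by (simp add: \<zeta>_def iter_add_int_pi)
  ultimately show ?thesis using \<open>\<zeta> \<le> \<xi>\<close> \<open>\<xi> \<le> \<zeta> + pi\<close> by simp
qed

lemma iter_quasi_cocycle: "quasi_cocycle pi (\<lambda>n t. iter P t n 0)"
  unfolding quasi_cocycle_def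
proof (intro allI)
  fix N L t
  show "\<bar>iter P t (N + L) 0 - iter P t N 0 - iter P (t + int N) L 0\<bar> \<le> pi"
    using iter_displacement[of "t + int N" L "iter P t N 0" 0] by (simp add: iter_add)
qed

end

section \<open>Point sets and total boundedness of the shifts\<close>


lemma point_sets_gap:
  assumes "G \<in> point_sets m M"
  shows "m \<le> G (i + 1) - G i" "G (i + 1) - G i \<le> M"
proof -
  have "G (i + 1) - G (i + 1 - 1) \<in> {m..M}" using assms unfolding point_sets_def by blast
  then show "m \<le> G (i + 1) - G i" "G (i + 1) - G i \<le> M" by simp_all
qed

lemma point_sets_gap_nat:
  assumes "G \<in> point_sets m M"
  shows "m * real n \<le> G (i + int n) - G i" "G (i + int n) - G i \<le> M * real n"
proof (induction n)
  case (Suc n)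
  case 1 show ?case using Suc(1) point_sets_gap(1)[OF assms, of "i + int n"] by (simp add: algebra_simps)
  case 2 show ?case using Suc(2) point_sets_gap(2)[OF assms, of "i + int n"] by (simp add: algebra_simps)
qed simp_all

lemma point_sets_gap_int:
  assumes "G \<in> point_sets m M" "i \<le> j"
  shows "m * real_of_int (j - i) \<le> G j - G i"
  using point_sets_gap_nat(1)[OF assms(1), of "nat (j - i)" i] assms(2) by simp

lemma point_sets_strict_mono:
  assumes "G \<in> point_sets m M" "0 < m" "i < j" shows "G i < G j"
proof -
  have "0 < m * real_of_int (j - i)" using assms by simp
  then show ?thesis using point_sets_gap_int[OF assms(1), of i j] assms(3) by linarith
qed

lemma point_sets_less_iff:
  assumes "G \<in> point_sets m M" "0 < m" shows "G i < G j \<longleftrightarrow> i < j"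
  using point_sets_strict_mono[OF assms] by (metis less_asym linorder_neqE)

lemma point_sets_cell_unique:
  assumes G: "G \<in> point_sets m M" "0 < m"
    and "G i \<le> x" "x < G (i + 1)" "G j \<le> x" "x < G (j + 1)"
  shows "i = j"
proof -
  have "G i < G (j + 1)" "G j < G (i + 1)" using assms by linarith+
  then have "i < j + 1" "j < i + 1" using point_sets_less_iff[OF G] by blast+
  then show ?thesis by simp
qed

lemma point_sets_open_cell:
  assumes G: "G \<in> point_sets m M" "0 < m" and x: "G n < x" "x < G (n + 1)"
  shows "x \<notin> range G"
proof
  assume "x \<in> range G"
  then obtain k where k: "x = G k" by (rule rangeE)
  then have "n < k" "k < n + 1" using x point_sets_less_iff[OF G] by simp_all
  then show False by simp
qed

lemma point_sets_cell:
  assumes G: "G \<in> point_sets m M" and m: "0 < m"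
  obtains i where "G i \<le> x" "x < G (i + 1)"
proof -
  obtain n :: nat where n: "\<bar>x\<bar> / m < real n" using reals_Archimedean2 by blast
  have "\<bar>x\<bar> < m * real n" using n m by (simp add: field_simps)
  moreover have "G 0 = 0" using G by (simp add: point_sets_def)
  ultimately have lo: "G (- int n) \<le> x" and hi: "x < G (int n)"
    using point_sets_gap_nat(1)[OF G, of n "- int n"] point_sets_gap_nat(1)[OF G, of n 0] by simp_all
  define S where "S = {i. - int n \<le> i \<and> i \<le> int n \<and> G i \<le> x}"
  have "finite S" unfolding S_def by (rule finite_subset[of _ "{- int n..int n}"]) auto
  moreover have ne: "- int n \<in> S" using lo by (simp add: S_def)
  ultimately have M: "Max S \<in> S" and ge: "\<And>i. i \<in> S \<Longrightarrow> i \<le> Max S" using Max_in by auto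
  have "Max S \<noteq> int n" using M hi by (auto simp: S_def)
  have "x < G (Max S + 1)"
  proof (rule ccontr)
    assume "\<not> ?thesis"
    then have "Max S + 1 \<in> S" using M \<open>Max S \<noteq> int n\<close> by (auto simp: S_def)
    from ge[OF this] show False by simp
  qed
  moreover have "G (Max S) \<le> x" using M by (simp add: S_def)
  ultimately show thesis using that by blast
qed

text \<open>
  The suprema and infima in the metric are real-valued, so they bound their terms only once boundedness
  is known: gaps at most \<open>M\<close> put a point of either set within \<open>M\<close> of every point of the other.
\<close>

lemma point_set_dist_lessD:
  assumes G: "G \<in> point_sets m M" and H: "H \<in> point_sets m M" and m: "0 < m"
    and d: "point_set_dist G H < r"
  shows "\<exists>j. \<bar>G i - H j\<bar> < r" "\<exists>j. \<bar>H i - G j\<bar> < r"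
proof -
  have *: "\<exists>j. \<bar>G i - H j\<bar> < r"
    if G: "G \<in> point_sets m M" and H: "H \<in> point_sets m M" and d: "(SUP i. INF j. \<bar>G i - H j\<bar>) < r" for G H i
  proof -
    have bb: "bdd_below (range (\<lambda>j. \<bar>G i - H j\<bar>))" for i by (auto intro: bdd_belowI[of _ 0])
    have "(INF j. \<bar>G i - H j\<bar>) \<le> M" for i
    proof -
      obtain j where "H j \<le> G i" "G i < H (j + 1)" by (rule point_sets_cell[OF H m])
      then have "\<bar>G i - H j\<bar> \<le> M" using point_sets_gap(2)[OF H, of j] by simp
      then show ?thesis using cINF_lower2[OF bb UNIV_I] by blast
    qed
    then have "bdd_above (range (\<lambda>i. INF j. \<bar>G i - H j\<bar>))" by (auto intro: bdd_aboveI[of _ M])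
    then have "(INF j. \<bar>G i - H j\<bar>) \<le> (SUP i. INF j. \<bar>G i - H j\<bar>)" by (rule cSUP_upper[OF UNIV_I])
    then have "(INF j. \<bar>G i - H j\<bar>) < r" using d by simp
    then show ?thesis using cINF_less_iff[OF UNIV_not_empty bb] by blast
  qed
  show "\<exists>j. \<bar>G i - H j\<bar> < r" "\<exists>j. \<bar>H i - G j\<bar> < r"
    using *[OF G H] *[OF H G] d by (simp_all add: point_set_dist_def)
qed

text \<open>
  Closeness of the sets implies closeness of the enumerations. Both start at 0, and if the points with
  index \<open>i\<close> match within \<open>r \<le> m / 2\<close>, then a point near the next point of one set must have a larger
  index than \<open>i\<close> in the other. Hence neither next point exceeds the other by \<open>r\<close>, and the induction goes
  on in both directions.
\<close>

lemma point_set_dist_matching: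
  assumes G: "G \<in> point_sets m M" and H: "H \<in> point_sets m M" and m: "0 < m"
    and d: "point_set_dist G H < r" and r: "2 * r \<le> m"
  shows "\<bar>G i - H i\<bar> < r"
proof -
  note near = point_set_dist_lessD[OF G H m d]
  have up: "G (i + 1) < H (i + 1) + r"
    if G: "G \<in> point_sets m M" and H: "H \<in> point_sets m M" and i: "\<bar>G i - H i\<bar> < r"
      and near: "\<exists>k. \<bar>H (i + 1) - G k\<bar> < r" for G H i
  proof -
    obtain k where k: "\<bar>H (i + 1) - G k\<bar> < r" using near by blast
    have "G i < G k" using k i r point_sets_gap(1)[OF H, of i] by linarith
    then have "i < k" using point_sets_less_iff[OF G m] by simp
    then have "G (i + 1) \<le> G k"
      using point_sets_less_iff[OF G m, of k "i + 1"] by force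
    then show ?thesis using k by linarith
  qed
  have down: "H (i - 1) - r < G (i - 1)"
    if G: "G \<in> point_sets m M" and H: "H \<in> point_sets m M" and i: "\<bar>G i - H i\<bar> < r"
      and near: "\<exists>k. \<bar>H (i - 1) - G k\<bar> < r" for G H i
  proof -
    obtain k where k: "\<bar>H (i - 1) - G k\<bar> < r" using near by blast
    have "G k < G i" using k i r point_sets_gap(1)[OF H, of "i - 1"] by simp
    then have "k < i" using point_sets_less_iff[OF G m] by simp
    then have "G k \<le> G (i - 1)"
      using point_sets_less_iff[OF G m, of "i - 1" k] by force
    then show ?thesis using k by linarith
  qed
  have "0 < r" using near(1)[of 0] by linarith
  show ?thesis
  proof (induction i rule: int_induct[where k = 0])
    case base
    then show ?case using G H \<open>0 < r\<close> by (simp add: point_sets_def)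
  next
    case (step1 i)
    have "G (i + 1) < H (i + 1) + r" by (rule up[OF G H step1(2) near(2)])
    moreover have "H (i + 1) < G (i + 1) + r"
      by (rule up[OF H G _ near(1)]) (use step1(2) in linarith)
    ultimately show ?case by linarith
  next
    case (step2 i)
    have "H (i - 1) - r < G (i - 1)" by (rule down[OF G H step2(2) near(2)])
    moreover have "G (i - 1) - r < H (i - 1)"
      by (rule down[OF H G _ near(1)]) (use step2(2) in linarith)
    ultimately show ?case by linarith
  qed
qed

lemma point_set_shift_in:
  assumes "G \<in> point_sets m M" shows "point_set_shift G t \<in> point_sets m M"
proof -
  have "G (i + t) - G (i + t - 1) \<in> {m..M}" for i using assms unfolding point_sets_def by blast
  then have "G (i + t) - G (i - 1 + t) \<in> {m..M}" for i by (simp add: algebra_simps)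
  then show ?thesis by (auto simp: point_sets_def point_set_shift_def)
qed

lemma PC_iff:
  "(f, V, G) \<in> PC m M \<longleftrightarrow>
     G \<in> point_sets m M \<and> bounded (range V) \<and>
     f \<in> extensional (- range G) \<and> bounded (f ` (- range G)) \<and>
     (\<forall>\<epsilon>>0. \<exists>\<delta>>0. \<forall>x y. connected_component (- range G) x y \<and> \<bar>x - y\<bar> < \<delta>
        \<longrightarrow> norm (f x - f y) < \<epsilon>)"
  unfolding PC_def by simp

lemma pc_shift_in:
  fixes p :: "'k::real_normed_field pc_triple"
  assumes "p \<in> PC m M" shows "pc_shift p t \<in> PC m M"
proof -
  obtain f V G where p: "p = (f, V, G)" by (cases p)
  note pc = assms[unfolded p PC_iff]
  note G = pc[THEN conjunct1] and V = pc[THEN conjunct2, THEN conjunct1]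
    and ext = pc[THEN conjunct2, THEN conjunct2, THEN conjunct1]
    and f = pc[THEN conjunct2, THEN conjunct2, THEN conjunct2, THEN conjunct1]
    and uc = pc[THEN conjunct2, THEN conjunct2, THEN conjunct2, THEN conjunct2]
  have mem: "x + G t \<in> - range G \<longleftrightarrow> x \<in> - range (point_set_shift G t)" for x
  proof -
    have "range (point_set_shift G t) = (\<lambda>y. y - G t) ` G ` range (\<lambda>i. i + t)"
      by (simp only: image_image point_set_shift_def)
    also have "range (\<lambda>i. i + t) = UNIV" by (rule surj_plus_right)
    finally show ?thesis
      by (simp add: image_iff eq_diff_eq)
  qed
  have conn: "connected_component (- range G) (x + G t) (y + G t)"
    if c: "connected_component (- range (point_set_shift G t)) x y" for x y
  proof -
    obtain T where T: "connected T" "T \<subseteq> - range (point_set_shift G t)" "x \<in> T" "y \<in> T"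
      using c unfolding connected_component_def by (elim exE conjE)
    have "connected ((\<lambda>z. z + G t) ` T)"
      by (intro connected_continuous_image T(1) continuous_intros)
    moreover have "(\<lambda>z. z + G t) ` T \<subseteq> - range G"
    proof (rule image_subsetI)
      fix z assume "z \<in> T"
      with T(2) have "z \<in> - range (point_set_shift G t)" by (rule subsetD)
      then show "z + G t \<in> - range G" by (simp only: mem)
    qed
    moreover have "x + G t \<in> (\<lambda>z. z + G t) ` T" "y + G t \<in> (\<lambda>z. z + G t) ` T"
      using T(3,4) by (simp_all add: imageI)
    ultimately show ?thesis unfolding connected_component_def by (intro exI conjI)
  qed
  have "bounded (range (bishift V t))"
    by (rule bounded_subset[OF V]) (auto simp: bishift_def)
  moreover have "(\<lambda>x. f (x + G t)) \<in> extensional (- range (point_set_shift G t))"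
  proof -
    have "f (x + G t) = undefined" if "x \<notin> - range (point_set_shift G t)" for x
    proof -
      have "x + G t \<notin> - range G" using that by (simp only: mem not_False_eq_True)
      with ext show ?thesis by (rule extensional_arb)
    qed
    then show ?thesis unfolding extensional_def by (intro CollectI allI impI)
  qed
  moreover have "bounded ((\<lambda>x. f (x + G t)) ` (- range (point_set_shift G t)))"
  proof (rule bounded_subset[OF f], rule image_subsetI)
    fix x assume "x \<in> - range (point_set_shift G t)"
    then have "x + G t \<in> - range G" by (simp only: mem)
    then show "f (x + G t) \<in> f ` (- range G)" by (rule imageI)
  qed
  moreover have "\<forall>\<epsilon>>0. \<exists>\<delta>>0. \<forall>x y. connected_component (- range (point_set_shift G t)) x y \<and> \<bar>x - y\<bar> < \<delta>
        \<longrightarrow> norm (f (x + G t) - f (y + G t)) < \<epsilon>"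
  proof (intro allI impI)
    fix e :: real assume "0 < e"
    then obtain k where k: "k > 0" "\<And>x y. connected_component (- range G) x y \<Longrightarrow> \<bar>x - y\<bar> < k
        \<Longrightarrow> norm (f x - f y) < e"
      using uc[rule_format, OF \<open>0 < e\<close>] by (elim exE conjE) (rule that, assumption, simp)
    show "\<exists>\<delta>>0. \<forall>x y. connected_component (- range (point_set_shift G t)) x y \<and> \<bar>x - y\<bar> < \<delta>
        \<longrightarrow> norm (f (x + G t) - f (y + G t)) < e"
      by (intro exI[of _ k] conjI k(1) allI impI k(2) conn) auto
  qed
  ultimately show ?thesis
    unfolding p pc_shift.simps PC_iff using point_set_shift_in[OF G] by (intro conjI)
qed

text \<open>
  A compact hull is totally bounded, so finitely many shifts \<open>s\<close>, all with \<open>\<bar>s\<bar> \<le> S\<close>, are \<open>r\<close>-dense among all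
  shifts.
\<close>

lemma PC_ap_shifts_close:
  assumes d: "PC_metric m M d" and p: "p \<in> PC_ap m M d" and r: "0 < r"
  shows "\<exists>(r' :: real) (S :: int). 0 < r' \<and> r' \<le> r \<and>
    (\<forall>a. \<exists>s. \<bar>s\<bar> \<le> S \<and> (pc_shift p s, pc_shift p a) \<in> entourage_S m M r')"
proof -
  interpret Metric_space "PC m M" d using d unfolding PC_metric_def by (rule conjunct1)
  have pPC: "p \<in> PC m M" and comp: "compactin mtopology (pc_hull m M d p)"
    using p unfolding PC_ap_def by simp_all
  have sub: "range (pc_shift p) \<subseteq> PC m M" by (intro image_subsetI pc_shift_in pPC)
  have "range (pc_shift p) \<subseteq> pc_hull m M d p"
    unfolding pc_hull_def by (rule closure_of_subset) (unfold topspace_mtopology, rule sub)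
  then have tb: "mtotally_bounded (range (pc_shift p))"
    by (rule mtotally_bounded_subset[OF compactin_imp_mtotally_bounded[OF comp]])
  obtain n :: nat where n: "1 / r < real n" using reals_Archimedean2 by blast
  define N where "N = Suc n"
  have "real n \<le> 2 ^ n" by (rule less_imp_le[OF of_nat_less_two_power])
  also have "(2::real) ^ n \<le> 4 ^ n" by (rule power_mono) simp_all
  also have "(4::real) ^ n \<le> 4 ^ N" unfolding N_def by (rule power_increasing) simp_all
  finally have "real n \<le> 4 ^ N" .
  then have "1 / r \<le> 4 ^ N" using n by linarith
  then have rN: "1 / 4 ^ N \<le> r" using r by (simp add: field_simps)
  obtain K where K: "finite K" "K \<subseteq> range (pc_shift p)"
      "range (pc_shift p) \<subseteq> (\<Union>x\<in>K. mball x (1 / 2 ^ Suc N))"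
  proof -
    have "(0::real) < 1 / 2 ^ Suc N" by simp
    from tb[unfolded mtotally_bounded_def, rule_format, OF this]
    show thesis using that by (elim exE conjE)
  qed
  obtain T where T: "finite T" "K = pc_shift p ` T" using finite_subset_image[OF K(1,2)] by (elim exE conjE)
  define S where "S = Max (abs ` T)"
  have S: "\<bar>s\<bar> \<le> S" if "s \<in> T" for s
    unfolding S_def using T(1) that by (intro Max_ge) auto
  have N1: "1 \<le> Suc N" by simp
  have UN: "entourage_U m M (Suc N - 1) = entourage_S m M (1 / 4 ^ N)"
    unfolding entourage_U_def by (simp only: diff_Suc_1 N_def nat.distinct if_False)
  note U = d[unfolded PC_metric_def, THEN conjunct2, rule_format, OF N1, THEN conjunct2, unfolded UN]
  show ?thesis
  proof (rule exI[of _ "1 / 4 ^ N"], rule exI[of _ S], intro conjI allI)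
    show "0 < (1 / 4 ^ N :: real)" "1 / 4 ^ N \<le> r" using rN by simp_all
    fix a
    have "pc_shift p a \<in> (\<Union>x\<in>K. mball x (1 / 2 ^ Suc N))" using K(3) by (rule subsetD) simp
    then obtain s where s: "s \<in> T" "pc_shift p a \<in> mball (pc_shift p s) (1 / 2 ^ Suc N)"
      unfolding T(2) by (elim UN_E imageE) simp
    from s(2) have "(pc_shift p s, pc_shift p a)
        \<in> {(p, p'). p \<in> PC m M \<and> p' \<in> PC m M \<and> d p p' < 1 / 2 ^ Suc N}"
      unfolding in_mball mem_Collect_eq prod.case .
    from subsetD[OF U this] show "\<exists>s. \<bar>s\<bar> \<le> S \<and> (pc_shift p s, pc_shift p a) \<in> entourage_S m M (1 / 4 ^ N)"
      using S[OF s(1)] by blast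
  qed
qed

section \<open>The jump as a time-one flow\<close>


lemma angle_path_nonzero: "Complex (cos \<xi> + t * c * sin \<xi>) (sin \<xi>) \<noteq> 0"
proof
  assume "Complex (cos \<xi> + t * c * sin \<xi>) (sin \<xi>) = 0"
  from arg_cong[OF this, of Im] arg_cong[OF this, of Re]
  have s: "sin \<xi> = 0" and "cos \<xi> + t * c * sin \<xi> = 0"
    by (simp_all only: complex.sel zero_complex.sel)
  then have "cos \<xi> = 0" unfolding s by simp
  with s have "sin \<xi> = 0" "cos \<xi> = 0" .
  then show False using sin_cos_squared_add[of \<xi>] by simp
qed

text \<open>
  Two continuous arguments of the same path differ by a continuous function with values in \<open>2 \<pi> \<int>\<close>. If it
  were not constant, it would pass through \<open>\<pi>\<close> or \<open>- \<pi>\<close>.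
\<close>

lemma continuous_argument_unique:
  fixes \<phi> \<psi> :: "real \<Rightarrow> real"
  assumes \<phi>: "continuous_on {0..1} \<phi>" "\<And>t. t \<in> {0..1} \<Longrightarrow> is_Arg (z t) (\<phi> t)"
    and \<psi>: "continuous_on {0..1} \<psi>" "\<And>t. t \<in> {0..1} \<Longrightarrow> is_Arg (z t) (\<psi> t)"
    and z: "\<And>t. t \<in> {0..1} \<Longrightarrow> z t \<noteq> 0" and start: "\<phi> 0 = \<psi> 0" and t: "t \<in> {0..1}"
  shows "\<phi> t = \<psi> t"
proof (rule ccontr)
  define D where "D s = \<phi> s - \<psi> s" for s
  assume "\<phi> t \<noteq> \<psi> t"
  then have Dt: "D t \<noteq> 0" by (simp add: D_def)
  have cosD: "cos (D s) = 1" if s: "s \<in> {0..1}" for s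
  proof -
    have "of_real (cmod (z s)) * exp (\<i> * of_real (\<phi> s)) = of_real (cmod (z s)) * exp (\<i> * of_real (\<psi> s))"
      using \<phi>(2)[OF s] \<psi>(2)[OF s] unfolding is_Arg_def by simp
    then have "exp (\<i> * of_real (\<phi> s)) = exp (\<i> * of_real (\<psi> s))" using z[OF s] by simp
    then have "cis (\<phi> s) = cis (\<psi> s)" by (simp add: cis_conv_exp)
    then have "cos (\<phi> s) = cos (\<psi> s)" "sin (\<phi> s) = sin (\<psi> s)" by (simp_all add: complex_eq_iff)
    then show ?thesis by (simp add: D_def cos_diff flip: power2_eq_square)
  qed
  \<comment> \<open>\<open>cos\<close> is below 1 on \<open>(0, \<pi>]\<close>\<close>
  have big: "pi < \<bar>D t\<bar>"
  proof (rule ccontr)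
    assume "\<not> ?thesis"
    then have "cos \<bar>D t\<bar> < cos 0" using Dt by (intro cos_monotone_0_pi) auto
    then show False using cosD[OF t] by simp
  qed
  have "connected (D ` {0..1})"
    unfolding D_def by (intro connected_continuous_image continuous_intros \<phi>(1) \<psi>(1)) simp
  moreover have "0 \<in> D ` {0..1}" "D t \<in> D ` {0..1}" using start t by (auto simp: D_def image_iff)
  ultimately have "{0..D t} \<subseteq> D ` {0..1}" "{D t..0} \<subseteq> D ` {0..1}"
    using connected_contains_Icc by blast+
  then have "pi \<in> D ` {0..1} \<or> - pi \<in> D ` {0..1}"
  proof (cases "0 < D t")
    case True
    then have "pi \<in> {0..D t}" using big by simp
    then show ?thesis using \<open>{0..D t} \<subseteq> D ` {0..1}\<close> by blast
  next
    case False
    then have "- pi \<in> {D t..0}" using big by simp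
    then show ?thesis using \<open>{D t..0} \<subseteq> D ` {0..1}\<close> by blast
  qed
  then obtain s where "s \<in> {0..1}" "D s = pi \<or> D s = - pi" by auto
  then show False using cosD[of s] by auto
qed

text \<open>
  Write \<open>x t + \<i> y\<close> for the path. Its component \<open>w\<close> orthogonal to the direction \<open>u t\<close> satisfies the linear
  equation \<open>w' = - c sin u cos u w\<close> with \<open>w 0 = 0\<close>, so \<open>w\<close> vanishes and \<open>u t\<close> is an argument up to sign. The
  component \<open>R\<close> along \<open>u t\<close> is 1 at the start and never zero, so the sign is right.
\<close>

lemma jump_arc_is_angle_path:
  assumes u: "pruefer_arc 0 (\<lambda>_. c) 0 1 u" and t: "t \<in> {0..1}"
  shows "is_Arg (Complex (cos (u 0) + t * c * sin (u 0)) (sin (u 0))) (u t)"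
proof -
  define x where "x s = cos (u 0) + s * c * sin (u 0)" for s
  define y where "y = sin (u 0)"
  define w where "w s = y * cos (u s) - x s * sin (u s)" for s
  define R where "R s = x s * cos (u s) + y * sin (u s)" for s
  have cont: "continuous_on {0..1} u"
    and der: "\<And>s. 0 < s \<Longrightarrow> s < 1 \<Longrightarrow> (u has_real_derivative - (c * (sin (u s))\<^sup>2)) (at s)"
    using u by (auto simp: pruefer_arc_def)
  have w0: "w s = 0" if s: "s \<in> {0..1}" for s
  proof -
    have "\<bar>w s\<bar> \<le> exp ((2 * \<bar>c\<bar> + 1) * (s - 0)) * (\<bar>w 0\<bar> + 0 * (1 + (s - 0)))"
    proof (rule gronwall)
      show "continuous_on {0..s} w"
        unfolding w_def x_def using s by (intro continuous_intros continuous_on_subset[OF cont]) auto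
      fix r assume r: "0 < r" "r < s"
      show "(w has_real_derivative - (c * sin (u r) * cos (u r)) * w r) (at r)"
      proof -
        have "(w has_real_derivative
            y * (- sin (u r) * - (c * (sin (u r))\<^sup>2))
              - (c * y * sin (u r) + x r * (cos (u r) * - (c * (sin (u r))\<^sup>2)))) (at r)"
          unfolding w_def x_def y_def using r s
          by (auto intro!: derivative_eq_intros der)
        also have "y * (- sin (u r) * - (c * (sin (u r))\<^sup>2))
              - (c * y * sin (u r) + x r * (cos (u r) * - (c * (sin (u r))\<^sup>2)))
            = - (c * sin (u r)) * (y * (1 - (sin (u r))\<^sup>2) - x r * cos (u r) * sin (u r))"
          by (simp add: algebra_simps power2_eq_square)
        also have "\<dots> = - (c * sin (u r) * cos (u r)) * w r"
          unfolding w_def cos_squared_eq[symmetric] by (simp add: algebra_simps power2_eq_square)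
        finally show ?thesis .
      qed
      have "\<bar>sin (u r)\<bar> * \<bar>cos (u r)\<bar> \<le> 1 * 1" by (intro mult_mono) auto
      then have "\<bar>c\<bar> * (\<bar>sin (u r)\<bar> * \<bar>cos (u r)\<bar>) * \<bar>w r\<bar> \<le> \<bar>c\<bar> * 1 * \<bar>w r\<bar>"
        by (intro mult_right_mono mult_left_mono) auto
      then show "\<bar>- (c * sin (u r) * cos (u r)) * w r\<bar> \<le> \<bar>c\<bar> * \<bar>w r\<bar> + 0"
        by (simp add: abs_mult mult.assoc)
    qed (use s in auto)
    moreover have "w 0 = 0" by (simp add: w_def x_def y_def)
    ultimately show ?thesis by simp
  qed
  have rep: "x s = R s * cos (u s) - w s * sin (u s)" "y = R s * sin (u s) + w s * cos (u s)" for s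
  proof -
    show "x s = R s * cos (u s) - w s * sin (u s)"
      unfolding R_def w_def using sin_cos_squared_add[of "u s"] by algebra
    show "y = R s * sin (u s) + w s * cos (u s)"
      unfolding R_def w_def using sin_cos_squared_add[of "u s"] by algebra
  qed
  have R0: "R s \<noteq> 0" if s: "s \<in> {0..1}" for s
    using rep[of s] w0[OF s] angle_path_nonzero[of "u 0" s c] unfolding x_def y_def
    by (auto simp: complex_eq_iff)
  have Rpos: "0 < R t"
  proof (rule ccontr)
    assume "\<not> ?thesis"
    moreover have "R 0 = 1"
      using sin_cos_squared_add[of "u 0"] by (simp add: R_def x_def y_def power2_eq_square)
    moreover have "continuous_on {0..t} R"
      unfolding R_def x_def using t by (intro continuous_intros continuous_on_subset[OF cont]) auto
    ultimately obtain s where "0 \<le> s" "s \<le> t" "R s = 0"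
      using IVT2'[of R t 0 0] t by auto
    then show False using R0[of s] t by auto
  qed
  have z: "Complex (x t) y = of_real (R t) * exp (\<i> * of_real (u t))"
    using rep[of t] w0[OF t] by (simp add: complex_eq_iff Re_exp Im_exp)
  then have "cmod (Complex (x t) y) = R t" using Rpos by (simp add: norm_mult)
  then show ?thesis using z unfolding is_Arg_def x_def y_def by simp
qed

lemma jump_interval: "pruefer_interval (\<lambda>_. c) 0 1 \<bar>c\<bar>"
  by unfold_locales (auto intro: uniformly_continuous_on_const)

lemma angle_F_arc:
  assumes u: "pruefer_arc 0 (\<lambda>_. c) 0 1 u" and t: "t \<in> {0..1}"
  shows "angle_F c t (u 0) = u t"
  unfolding angle_F_def
proof (rule the_equality)
  have "continuous_on {0..1} u" using u by (simp add: pruefer_arc_def)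
  then show "\<exists>\<phi>. continuous_on {0..1} \<phi> \<and> \<phi> 0 = u 0 \<and>
      (\<forall>s\<in>{0..1}. is_Arg (Complex (cos (u 0) + s * c * sin (u 0)) (sin (u 0))) (\<phi> s)) \<and> u t = \<phi> t"
    using jump_arc_is_angle_path[OF u] by blast
  fix y assume "\<exists>\<phi>. continuous_on {0..1} \<phi> \<and> \<phi> 0 = u 0 \<and>
      (\<forall>s\<in>{0..1}. is_Arg (Complex (cos (u 0) + s * c * sin (u 0)) (sin (u 0))) (\<phi> s)) \<and> y = \<phi> t"
  then obtain \<phi> where \<phi>: "continuous_on {0..1} \<phi>" "\<phi> 0 = u 0"
      "\<forall>s\<in>{0..1}. is_Arg (Complex (cos (u 0) + s * c * sin (u 0)) (sin (u 0))) (\<phi> s)" "y = \<phi> t"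
    by (elim exE conjE)
  have "\<phi> t = u t"
    by (rule continuous_argument_unique[where z = "\<lambda>s. Complex (cos (u 0) + s * c * sin (u 0)) (sin (u 0))"])
      (use \<phi> t \<open>continuous_on {0..1} u\<close> jump_arc_is_angle_path[OF u] angle_path_nonzero in auto)
  then show "y = u t" using \<phi>(4) by simp
qed

lemma angle_J_transport: "angle_J c \<xi> = transport 0 (\<lambda>_. c) 0 1 \<xi> - \<xi>"
proof -
  interpret pruefer_interval 0 "\<lambda>_. c" 0 1 "\<bar>c\<bar>" by (rule jump_interval)
  obtain u where u: "pruefer_arc 0 (\<lambda>_. c) 0 1 u" "u 0 = \<xi>" "transport 0 (\<lambda>_. c) 0 1 \<xi> = u 1"
    by (rule transport_arcE)
  show ?thesis using angle_F_arc[OF u(1), of 0] angle_F_arc[OF u(1), of 1] u by (simp add: angle_J_def)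
qed

section \<open>The node-to-node maps of a Pruefer system\<close>


text \<open>
  The spectral parameter is absorbed in the coefficient: \<open>b\<close> plays the part of \<open>q - E\<close>. The bounds \<open>K\<close> and
  \<open>Kv\<close> are parameters so that systems for different energies can share the same constants.
\<close>

locale pruefer_system =
  fixes m M K Kv :: real and G :: "int \<Rightarrow> real" and V :: "int \<Rightarrow> real" and b :: "real \<Rightarrow> real"
  assumes m: "0 < m" and G: "G \<in> point_sets m M"
    and b_unif: "\<And>n. uniformly_continuous_on {G n<..<G (n + 1)} b"
    and b_bound: "\<And>x. x \<notin> range G \<Longrightarrow> \<bar>b x\<bar> \<le> K" and K_nonneg: "0 \<le> K"
    and V_bound: "\<And>n. \<bar>V n\<bar> \<le> Kv"
begin

lemma G_less: "G n < G (n + 1)"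
  using point_sets_strict_mono[OF G m] by simp

lemma cell_not_point: "G n < x \<Longrightarrow> x < G (n + 1) \<Longrightarrow> x \<notin> range G"
  by (rule point_sets_open_cell[OF G m])

sublocale interval: pruefer_interval 1 b "G n" "G (n + 1)" K for n
proof
  show "G n < G (n + 1)" by (rule G_less)
  show "uniformly_continuous_on {G n<..<G (n + 1)} b" by (rule b_unif)
  show "0 \<le> K" by (rule K_nonneg)
  show "\<bar>b x\<bar> \<le> K" if "G n < x" "x < G (n + 1)" for x
    using b_bound cell_not_point[OF that] by blast
qed

lemma Kv_nonneg: "0 \<le> Kv"
  using V_bound[of 0] by linarith

sublocale jump: pruefer_interval 0 "\<lambda>_. V n" 0 1 Kv for n
  by unfold_locales (auto intro: uniformly_continuous_on_const V_bound Kv_nonneg)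

text \<open>
  \<open>step n\<close> maps the angle just after the point \<open>G n\<close> to the angle just after \<open>G (n + 1)\<close>; the jump at
  \<open>G (n + 1)\<close> belongs to it because solutions are right-continuous.
\<close>

definition step :: "int \<Rightarrow> real \<Rightarrow> real" where
  "step n \<xi> = transport 0 (\<lambda>_. V (n + 1)) 0 1 (transport 1 b (G n) (G (n + 1)) \<xi>)"

definition "step_lipschitz = exp ((2 * Kv + 1)) * exp ((2 * (1 + K) + 1) * M)"

lemma gap_le: "G (n + 1) - G n \<le> M" by (rule point_sets_gap(2)[OF G])

lemma M_pos: "0 < M" using gap_le[of 0] G_less[of 0] by linarith

sublocale circle_lifts step
proof
  show "step i \<xi> \<le> step i \<eta>" if "\<xi> \<le> \<eta>" for i \<xi> \<eta>
    unfolding step_def by (intro jump.transport_mono interval.transport_mono that)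
  show "step i (\<xi> + pi) = step i \<xi> + pi" for i \<xi>
    unfolding step_def by (simp only: jump.transport_add_pi interval.transport_add_pi)
qed

lemma interval_growth_le: "exp ((2 * (1 + K) + 1) * (G (n + 1) - G n)) \<le> exp ((2 * (1 + K) + 1) * M)"
  using gap_le K_nonneg by (auto intro!: mult_left_mono)

lemma step_lipschitz_le: "\<bar>step n \<xi> - step n \<eta>\<bar> \<le> step_lipschitz * \<bar>\<xi> - \<eta>\<bar>"
proof -
  have "\<bar>step n \<xi> - step n \<eta>\<bar> \<le> exp (2 * Kv + 1) *
      \<bar>transport 1 b (G n) (G (n + 1)) \<xi> - transport 1 b (G n) (G (n + 1)) \<eta>\<bar>"
    unfolding step_def using jump.transport_lipschitz[of "n + 1"] by (simp add: jump.growth_def)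
  also have "\<dots> \<le> exp (2 * Kv + 1) * (exp ((2 * (1 + K) + 1) * (G (n + 1) - G n)) * \<bar>\<xi> - \<eta>\<bar>)"
    using interval.transport_lipschitz[of n \<xi> \<eta>] by (simp add: interval.growth_def)
  also have "\<dots> \<le> exp (2 * Kv + 1) * (exp ((2 * (1 + K) + 1) * M) * \<bar>\<xi> - \<eta>\<bar>)"
    by (intro mult_left_mono mult_right_mono interval_growth_le) auto
  finally show ?thesis by (simp add: step_lipschitz_def mult.assoc)
qed

lemma step_lipschitz_ge_1: "1 \<le> step_lipschitz"
proof -
  have "0 \<le> 2 * Kv + 1 + (2 * (1 + K) + 1) * M" using Kv_nonneg K_nonneg M_pos by simp
  then show ?thesis by (simp add: step_lipschitz_def flip: exp_add)
qed

lemma step_inj: "step n \<xi> = step n \<eta> \<Longrightarrow> \<xi> = \<eta>"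
  unfolding step_def by (drule jump.transport_inj) (rule interval.transport_inj)

lemma step_displacement: "\<bar>step n \<xi> - \<xi>\<bar> \<le> (1 + K) * M + Kv"
proof -
  let ?\<eta> = "transport 1 b (G n) (G (n + 1)) \<xi>"
  have "\<bar>step n \<xi> - ?\<eta>\<bar> \<le> Kv"
    unfolding step_def using jump.transport_displacement[of "n + 1" ?\<eta>] by simp
  moreover have "\<bar>?\<eta> - \<xi>\<bar> \<le> (1 + K) * (G (n + 1) - G n)"
    using interval.transport_displacement[of n \<xi>] by simp
  moreover have "(1 + K) * (G (n + 1) - G n) \<le> (1 + K) * M"
    using gap_le K_nonneg by (intro mult_left_mono) auto
  ultimately show ?thesis by linarith
qed

text \<open>
  A continuous map at bounded distance from the identity is onto. This yields values to the left of 0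
  without solving the equation backwards.
\<close>

lemma step_surj: "\<exists>\<xi>. step n \<xi> = \<eta>"
proof -
  define B where "B = (1 + K) * M + Kv"
  have B: "\<bar>step n \<xi> - \<xi>\<bar> \<le> B" for \<xi> using step_displacement by (simp add: B_def)
  have "isCont (step n) x" for x
    unfolding isCont_def
  proof (rule LIM_I)
    fix e :: real assume e: "0 < e"
    have "norm (step n y - step n x) < e" if y: "norm (y - x) < e / step_lipschitz" for y
    proof -
      have "\<bar>y - x\<bar> * step_lipschitz < e"
        using y step_lipschitz_ge_1 by (simp add: field_simps)
      then show ?thesis using step_lipschitz_le[of n y x] by (simp add: mult.commute)
    qed
    then show "\<exists>s>0. \<forall>y. y \<noteq> x \<and> norm (y - x) < s \<longrightarrow> norm (step n y - step n x) < e"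
      using e step_lipschitz_ge_1 by (intro exI[of _ "e / step_lipschitz"]) auto
  qed
  moreover have "step n (\<eta> - B) \<le> \<eta>" "\<eta> \<le> step n (\<eta> + B)" "\<eta> - B \<le> \<eta> + B"
    using B[of "\<eta> - B"] B[of "\<eta> + B"] by linarith+
  ultimately show ?thesis using IVT[of "step n" "\<eta> - B" \<eta> "\<eta> + B"] by blast
qed

lemma node_values_exist: "\<exists>a. a 0 = \<xi> \<and> (\<forall>n. a (n + 1) = step n (a n))"
proof -
  obtain pre where pre: "\<And>n \<eta>. step n (pre n \<eta>) = \<eta>" using step_surj by metis
  \<comment> \<open>\<open>neg k\<close> is the value at the node \<open>- k\<close>\<close>
  define neg where "neg = rec_nat \<xi> (\<lambda>k. pre (- int k - 1))"
  have neg: "neg 0 = \<xi>" "\<And>k. neg (Suc k) = pre (- int k - 1) (neg k)" by (simp_all add: neg_def)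
  define a where "a n = (if 0 \<le> n then iter step 0 (nat n) \<xi> else neg (nat (- n)))" for n
  show ?thesis
  proof (intro exI[of _ a] conjI allI)
    show "a 0 = \<xi>" by (simp add: a_def)
    fix n
    show "a (n + 1) = step n (a n)"
    proof (cases "0 \<le> n")
      case True
      then have "nat (n + 1) = Suc (nat n)" by simp
      then show ?thesis using True by (simp add: a_def)
    next
      case False
      define k where "k = nat (- n - 1)"
      have k: "n = - int k - 1" using False by (simp add: k_def)
      have "a n = neg (Suc k)" using False k by (simp add: a_def nat_add_distrib)
      moreover have "a (n + 1) = neg k" by (cases "k = 0") (simp_all add: a_def k neg(1))
      ultimately show ?thesis using pre[of n "neg k"] neg(2)[of k] k by simp
    qed
  qed
qed

lemma node_values_unique:
  assumes a: "a 0 = \<xi>" "\<And>n. a (n + 1) = step n (a n)"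
    and a': "a' 0 = \<xi>" "\<And>n. a' (n + 1) = step n (a' n)"
  shows "a n = a' n"
proof (induction n rule: int_induct[where k = 0])
  case base then show ?case using a a' by simp
next
  case (step1 n) then show ?case using a(2) a'(2) by simp
next
  case (step2 n)
  then have "step (n - 1) (a (n - 1)) = step (n - 1) (a' (n - 1))"
    using a(2)[of "n - 1"] a'(2)[of "n - 1"] by simp
  then show ?case by (rule step_inj)
qed

lemma node_values_iter:
  assumes a: "a 0 = \<xi>" "\<And>n. a (n + 1) = step n (a n)"
  shows "a (int n) = iter step 0 n \<xi>"
proof (induction n)
  case (Suc n) then show ?case using a(2)[of "int n"] by (simp add: add.commute)
qed (simp add: a)

end

section \<open>Pruefer angles and the rotation number\<close>


context pruefer_system
begin

text \<open>
  On the closed interval the solution must be redefined at the right end by its left limit. The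
  redefined function is an arc, and the jump condition there says that \<open>step n\<close> gives the actual value.
\<close>

lemma solution_cell:
  assumes sol: "pruefer_solution (b, V, G) 0 \<xi> \<theta>"
  shows "\<exists>u. pruefer_arc 1 b (G n) (G (n + 1)) u \<and> (\<forall>x\<in>{G n..<G (n + 1)}. u x = \<theta> x)"
    and "\<theta> (G (n + 1)) = step n (\<theta> (G n))"
proof -
  have right: "(\<theta> \<longlongrightarrow> \<theta> x) (at_right x)" for x
    using sol unfolding pruefer_solution_def by (simp add: continuous_within)
  have der: "(\<theta> has_real_derivative (cos (\<theta> x))\<^sup>2 - b x * (sin (\<theta> x))\<^sup>2) (at x)"
    if "x \<in> {G n<..<G (n + 1)}" for x
    using sol cell_not_point[of n x] that unfolding pruefer_solution_def by simp
  obtain l r where l: "(\<theta> \<longlongrightarrow> l) (at_left (G (n + 1)))" and r: "(\<theta> \<longlongrightarrow> r) (at_right (G (n + 1)))"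
    and lr: "r - l = angle_J (V (n + 1)) l"
    using sol unfolding pruefer_solution_def prod.case by blast
  have r_eq: "r = \<theta> (G (n + 1))" by (rule tendsto_unique[OF _ r right]) simp
  define u where "u x = (if x < G (n + 1) then \<theta> x else l)" for x
  have u_inner: "u x = \<theta> x" if "x \<in> {..<G (n + 1)}" for x using that by (simp add: u_def)
  have u_der: "(u has_real_derivative (cos (u x))\<^sup>2 - b x * (sin (u x))\<^sup>2) (at x)"
    if x: "x \<in> {G n<..<G (n + 1)}" for x
  proof -
    have "(u has_real_derivative (cos (\<theta> x))\<^sup>2 - b x * (sin (\<theta> x))\<^sup>2) (at x)"
      by (rule has_field_derivative_transform_within_open[OF der[OF x] open_greaterThanLessThan x])
         (simp add: u_def)
    then show ?thesis using u_inner x by simp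
  qed
  have "continuous_on {G n..G (n + 1)} u"
  proof (rule continuous_on_IccI)
    have "(u \<longlongrightarrow> \<theta> (G n)) (at_right (G n))"
    proof (rule Lim_transform_eventually[OF right])
      show "\<forall>\<^sub>F x in at_right (G n). \<theta> x = u x"
        unfolding eventually_at_right_field using G_less[of n] by (auto simp: u_def)
    qed
    then show "(u \<longlongrightarrow> u (G n)) (at_right (G n))" using G_less[of n] by (simp add: u_def)
    have "(u \<longlongrightarrow> l) (at_left (G (n + 1)))"
    proof (rule Lim_transform_eventually[OF l])
      show "\<forall>\<^sub>F x in at_left (G (n + 1)). \<theta> x = u x"
        unfolding eventually_at_left_field using G_less[of n] by (auto simp: u_def)
    qed
    then show "(u \<longlongrightarrow> u (G (n + 1))) (at_left (G (n + 1)))" by (simp add: u_def)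
    show "u \<midarrow>x\<rightarrow> u x" if "G n < x" "x < G (n + 1)" for x
      using DERIV_isCont[OF u_der[of x]] that by (simp add: isCont_def)
    show "G n < G (n + 1)" by (rule G_less)
  qed
  then have u: "pruefer_arc 1 b (G n) (G (n + 1)) u" using u_der by (simp add: pruefer_arc_def)
  have "transport 1 b (G n) (G (n + 1)) (\<theta> (G n)) = l"
    using interval.transport_arc[OF u] G_less[of n] by (simp add: u_def)
  then show "\<theta> (G (n + 1)) = step n (\<theta> (G n))"
    using lr r_eq by (simp add: step_def angle_J_transport)
  show "\<exists>u. pruefer_arc 1 b (G n) (G (n + 1)) u \<and> (\<forall>x\<in>{G n..<G (n + 1)}. u x = \<theta> x)"
    using u by (intro exI[of _ u] conjI) (auto simp: u_def)
qed

lemma solution_exists: "\<exists>\<theta>. pruefer_solution (b, V, G) 0 \<xi> \<theta>"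
proof -
  obtain a where a: "a 0 = \<xi>" "\<And>n. a (n + 1) = step n (a n)" using node_values_exist[of \<xi>] by blast
  have "\<forall>n. \<exists>u. pruefer_arc 1 b (G n) (G (n + 1)) u \<and> u (G n) = a n"
    using interval.arc_exists by blast
  from choice[OF this]
  obtain u where u: "\<And>n. pruefer_arc 1 b (G n) (G (n + 1)) (u n)" and ua: "\<And>n. u n (G n) = a n"
    by blast
  define cell where "cell x = (THE n. G n \<le> x \<and> x < G (n + 1))" for x
  have cell: "cell x = n" if "G n \<le> x" "x < G (n + 1)" for x n
    unfolding cell_def
    by (rule the_equality) (use that point_sets_cell_unique[OF G m] in auto)
  define \<theta> where "\<theta> x = u (cell x) x" for x
  have \<theta>: "\<theta> x = u n x" if "x \<in> {G n..<G (n + 1)}" for x n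
    using cell[of n x] that by (simp add: \<theta>_def)
  have cont: "continuous_on {G n..G (n + 1)} (u n)" for n using u[of n] by (simp add: pruefer_arc_def)
  have \<theta>G: "\<theta> (G n) = a n" for n using \<theta>[of "G n" n] G_less[of n] ua by simp
  have der: "(\<theta> has_real_derivative (cos (\<theta> x))\<^sup>2 - b x * (sin (\<theta> x))\<^sup>2) (at x)"
    if x: "x \<in> {G n<..<G (n + 1)}" for x n
  proof -
    have "(u n has_real_derivative (cos (u n x))\<^sup>2 - b x * (sin (u n x))\<^sup>2) (at x)"
      using u[of n] x by (simp add: pruefer_arc_def)
    then have "(\<theta> has_real_derivative (cos (u n x))\<^sup>2 - b x * (sin (u n x))\<^sup>2) (at x)"
      by (rule has_field_derivative_transform_within_open[OF _ open_greaterThanLessThan x])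
         (rule \<theta>[symmetric], simp)
    then show ?thesis using \<theta>[of x n] x by simp
  qed
  have right_G: "(\<theta> \<longlongrightarrow> \<theta> (G n)) (at_right (G n))" for n
  proof -
    have "(u n \<longlongrightarrow> u n (G n)) (at_right (G n))"
      by (rule continuous_on_Icc_at_rightD[OF cont G_less])
    then have "(\<theta> \<longlongrightarrow> u n (G n)) (at_right (G n))"
    proof (rule Lim_transform_eventually)
      show "\<forall>\<^sub>F x in at_right (G n). u n x = \<theta> x"
        unfolding eventually_at_right_field
      proof (intro exI[of _ "G (n + 1)"] conjI G_less allI impI)
        fix y assume "G n < y" "y < G (n + 1)"
        then show "u n y = \<theta> y" using \<theta>[of y n] by simp
      qed
    qed
    then show ?thesis using \<theta>G ua by simp
  qed
  have in_cell: "\<exists>n. x = G n \<or> x \<in> {G n<..<G (n + 1)}" for x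
  proof -
    obtain n where "G n \<le> x" "x < G (n + 1)" by (rule point_sets_cell[OF G m])
    then show ?thesis by (intro exI[of _ n]) auto
  qed
  have left_G: "(\<theta> \<longlongrightarrow> u (n - 1) (G n)) (at_left (G n))" for n
  proof -
    have "(u (n - 1) \<longlongrightarrow> u (n - 1) (G n)) (at_left (G n))"
      using continuous_on_Icc_at_leftD[OF cont[of "n - 1"] G_less] by simp
    then show ?thesis
    proof (rule Lim_transform_eventually)
      show "\<forall>\<^sub>F x in at_left (G n). u (n - 1) x = \<theta> x"
        unfolding eventually_at_left_field using G_less[of "n - 1"] \<theta>[of _ "n - 1"]
        by (auto intro!: exI[of _ "G (n - 1)"])
    qed
  qed
  have jump: "\<theta> (G n) - u (n - 1) (G n) = angle_J (V n) (u (n - 1) (G n))" for n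
  proof -
    have "transport 1 b (G (n - 1)) (G n) (a (n - 1)) = u (n - 1) (G n)"
      using interval.transport_arc[OF u[of "n - 1"]] ua[of "n - 1"] by simp
    then have "a n = transport 0 (\<lambda>_. V n) 0 1 (u (n - 1) (G n))"
      using a(2)[of "n - 1"] by (simp add: step_def)
    then show ?thesis by (simp add: \<theta>G angle_J_transport)
  qed
  have "pruefer_solution (b, V, G) 0 \<xi> \<theta>"
    unfolding pruefer_solution_def prod.case
  proof (intro conjI allI impI)
    show "\<theta> 0 = \<xi>" using \<theta>G[of 0] a(1) G by (simp add: point_sets_def)
    show "continuous (at_right x) \<theta>" for x
    proof -
      obtain n where "x = G n \<or> x \<in> {G n<..<G (n + 1)}" using in_cell by blast
      then show ?thesis
      proof
        assume "x = G n"
        then show ?thesis using right_G[of n] by (simp add: continuous_within)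
      next
        assume "x \<in> {G n<..<G (n + 1)}"
        then show ?thesis
          by (rule continuous_at_imp_continuous_within[OF DERIV_isCont[OF der]])
      qed
    qed
    show "(\<theta> has_real_derivative (cos (\<theta> x))\<^sup>2 - (b x - 0) * (sin (\<theta> x))\<^sup>2) (at x)"
      if x: "x \<notin> range G" for x
    proof -
      obtain n where "x = G n \<or> x \<in> {G n<..<G (n + 1)}" using in_cell by blast
      then show ?thesis using der[of x n] x by auto
    qed
    show "\<exists>l r. (\<theta> \<longlongrightarrow> l) (at_left (G n)) \<and> (\<theta> \<longlongrightarrow> r) (at_right (G n)) \<and> r - l = angle_J (V n) l" for n
      using left_G[of n] right_G[of n] jump[of n] by (intro exI conjI)
  qed
  then show ?thesis by blast
qed

lemma solution_nodes:
  assumes sol: "pruefer_solution (b, V, G) 0 \<xi> \<theta>"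
  shows "\<theta> (G 0) = \<xi>" "\<theta> (G (n + 1)) = step n (\<theta> (G n))"
proof -
  show "\<theta> (G 0) = \<xi>" using sol G by (simp add: pruefer_solution_def point_sets_def)
  show "\<theta> (G (n + 1)) = step n (\<theta> (G n))" by (rule solution_cell(2)[OF sol])
qed

lemma solution_unique:
  assumes sol: "pruefer_solution (b, V, G) 0 \<xi> \<theta>" "pruefer_solution (b, V, G) 0 \<xi> \<theta>'"
  shows "\<theta> = \<theta>'"
proof
  fix x
  obtain n where n: "G n \<le> x" "x < G (n + 1)" by (rule point_sets_cell[OF G m])
  obtain u where u: "pruefer_arc 1 b (G n) (G (n + 1)) u" "\<And>x. x \<in> {G n..<G (n + 1)} \<Longrightarrow> u x = \<theta> x"
    using solution_cell(1)[OF sol(1), of n] by blast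
  obtain u' where u': "pruefer_arc 1 b (G n) (G (n + 1)) u'" "\<And>x. x \<in> {G n..<G (n + 1)} \<Longrightarrow> u' x = \<theta>' x"
    using solution_cell(1)[OF sol(2), of n] by blast
  have "\<theta> (G n) = \<theta>' (G n)"
    by (rule node_values_unique[where a = "\<lambda>n. \<theta> (G n)" and a' = "\<lambda>n. \<theta>' (G n)" and \<xi> = \<xi>])
       (use solution_nodes[OF sol(1)] solution_nodes[OF sol(2)] in auto)
  then have "u (G n) = u' (G n)" using u(2)[of "G n"] u'(2)[of "G n"] G_less[of n] by simp
  from interval.arc_unique[OF u(1) u'(1) this n(1)] n show "\<theta> x = \<theta>' x" using u(2) u'(2) by simp
qed

lemma pruefer_angle_solution: "pruefer_solution (b, V, G) 0 \<xi> (pruefer_angle (b, V, G) 0 \<xi>)"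
proof -
  have "\<exists>!\<theta>. pruefer_solution (b, V, G) 0 \<xi> \<theta>"
    by (rule ex_ex1I, rule solution_exists) (rule solution_unique)
  from theI'[OF this] show ?thesis unfolding pruefer_angle_def .
qed

lemma pruefer_angle_near_node:
  assumes "G (int n) \<le> x" "x < G (int n + 1)"
  shows "\<bar>pruefer_angle (b, V, G) 0 \<xi> x - \<xi> - iter step 0 n 0\<bar> \<le> (1 + K) * M + pi"
proof -
  let ?\<theta> = "pruefer_angle (b, V, G) 0 \<xi>"
  note sol = pruefer_angle_solution[of \<xi>]
  obtain u where u: "pruefer_arc 1 b (G (int n)) (G (int n + 1)) u"
      "\<And>x. x \<in> {G (int n)..<G (int n + 1)} \<Longrightarrow> u x = ?\<theta> x"
    using solution_cell(1)[OF sol, of "int n"] by blast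
  have "\<bar>u x - u (G (int n))\<bar> \<le> (\<bar>1\<bar> + K) * (x - G (int n))"
    by (rule pruefer_arc_speed[OF u(1)]) (use assms interval.bound in auto)
  also have "\<dots> \<le> (1 + K) * M"
    using assms gap_le[of "int n"] K_nonneg by (simp add: mult_left_mono)
  finally have "\<bar>?\<theta> x - ?\<theta> (G (int n))\<bar> \<le> (1 + K) * M" using u(2) assms G_less[of "int n"] by simp
  moreover have "?\<theta> (G (int n)) = iter step 0 n \<xi>"
    using node_values_iter[of "\<lambda>n. ?\<theta> (G n)"] solution_nodes[OF sol] by simp
  moreover have "\<bar>(iter step 0 n \<xi> - \<xi>) - (iter step 0 n 0 - 0)\<bar> \<le> pi" by (rule iter_displacement)
  ultimately show ?thesis by linarith
qed

text \<open>
  With \<open>N x\<close> the index of the last point up to \<open>x\<close>, the angle at \<open>x\<close> and the displacement after \<open>N x\<close> steps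
  differ by a bounded amount, and so do \<open>x\<close> and \<open>G (N x)\<close>. Dividing both by \<open>N x\<close> reduces the limit over \<open>x\<close>
  to the two limits over \<open>n\<close>.
\<close>

lemma rotation_limit:
  assumes \<beta>: "(\<lambda>n. iter step 0 n 0 / real n) \<longlonglongrightarrow> \<beta>" and \<gamma>: "(\<lambda>n. G (int n) / real n) \<longlonglongrightarrow> \<gamma>"
  shows "((\<lambda>x. (pruefer_angle (b, V, G) 0 \<xi> x - \<xi>) / x) \<longlongrightarrow> \<beta> / \<gamma>) at_top"
proof -
  let ?\<theta> = "pruefer_angle (b, V, G) 0 \<xi>"
  let ?C = "(1 + K) * M + pi"
  have G0: "G 0 = 0" using G by (simp add: point_sets_def)
  have "m \<le> \<gamma>"
  proof (rule LIMSEQ_le_const[OF \<gamma>], intro exI[of _ 1] allI impI)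
    fix n :: nat assume "1 \<le> n"
    then show "m \<le> G (int n) / real n"
      using point_sets_gap_nat(1)[OF G, of n 0] G0 by (simp add: field_simps)
  qed
  then have \<gamma>0: "\<gamma> \<noteq> 0" using m by simp
  have "\<exists>n. 0 \<le> x \<longrightarrow> G (int n) \<le> x \<and> x < G (int n + 1)" for x
  proof -
    obtain i where i: "G i \<le> x" "x < G (i + 1)" by (rule point_sets_cell[OF G m])
    have "0 \<le> i" if "0 \<le> x"
    proof -
      have "G 0 < G (i + 1)" using i that G0 by simp
      then show ?thesis using point_sets_less_iff[OF G m] by simp
    qed
    then show ?thesis using i by (intro exI[of _ "nat i"]) auto
  qed
  then have "\<forall>x. \<exists>n. 0 \<le> x \<longrightarrow> G (int n) \<le> x \<and> x < G (int n + 1)" by blast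
  from choice[OF this]
  obtain N where N: "\<And>x. 0 \<le> x \<Longrightarrow> G (int (N x)) \<le> x" "\<And>x. 0 \<le> x \<Longrightarrow> x < G (int (N x) + 1)"
    by blast
  have N_lower: "x / M - 1 \<le> real (N x)" if "0 \<le> x" for x
    using N(2)[OF that] point_sets_gap_nat(2)[OF G, of 0 "Suc (N x)"] M_pos G0
    by (simp add: field_simps)
  have N_top: "filterlim N sequentially at_top"
    unfolding filterlim_at_top
  proof
    fix k :: nat
    show "\<forall>\<^sub>F x in at_top. k \<le> N x"
      using eventually_ge_at_top[of "(real k + 1) * M"]
    proof eventually_elim
      case (elim x)
      have "0 \<le> (real k + 1) * M" using M_pos by simp
      with elim have x: "0 \<le> x" by linarith
      have "real k + 1 \<le> x / M" using elim M_pos by (simp add: field_simps)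
      then show ?case using N_lower[OF x] by linarith
    qed
  qed
  have inv: "((\<lambda>x. C / real (N x)) \<longlongrightarrow> 0) at_top" for C :: real
    by (rule filterlim_compose[OF lim_const_over_n N_top])
  have lim1: "((\<lambda>x. (?\<theta> x - \<xi>) / real (N x)) \<longlongrightarrow> \<beta>) at_top"
  proof (rule Lim_transform2)
    show "((\<lambda>x. iter step 0 (N x) 0 / real (N x)) \<longlongrightarrow> \<beta>) at_top"
      by (rule filterlim_compose[OF \<beta> N_top])
    show "((\<lambda>x. iter step 0 (N x) 0 / real (N x) - (?\<theta> x - \<xi>) / real (N x)) \<longlongrightarrow> 0) at_top"
    proof (rule Lim_null_comparison[OF _ inv[of ?C]])
      show "\<forall>\<^sub>F x in at_top. norm (iter step 0 (N x) 0 / real (N x) - (?\<theta> x - \<xi>) / real (N x)) \<le> ?C / real (N x)"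
        using eventually_ge_at_top[of "0::real"]
      proof eventually_elim
        case (elim x)
        have "\<bar>iter step 0 (N x) 0 - (?\<theta> x - \<xi>)\<bar> \<le> ?C"
          using pruefer_angle_near_node[OF N(1)[OF elim] N(2)[OF elim], of \<xi>] by linarith
        then have "\<bar>iter step 0 (N x) 0 - (?\<theta> x - \<xi>)\<bar> / real (N x) \<le> ?C / real (N x)"
          by (rule divide_right_mono) simp
        then show ?case by (simp flip: diff_divide_distrib)
      qed
    qed
  qed
  have lim2: "((\<lambda>x. x / real (N x)) \<longlongrightarrow> \<gamma>) at_top"
  proof (rule Lim_transform2)
    show "((\<lambda>x. G (int (N x)) / real (N x)) \<longlongrightarrow> \<gamma>) at_top"
      by (rule filterlim_compose[OF \<gamma> N_top])
    show "((\<lambda>x. G (int (N x)) / real (N x) - x / real (N x)) \<longlongrightarrow> 0) at_top"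
    proof (rule Lim_null_comparison[OF _ inv[of M]])
      show "\<forall>\<^sub>F x in at_top. norm (G (int (N x)) / real (N x) - x / real (N x)) \<le> M / real (N x)"
        using eventually_ge_at_top[of "0::real"]
      proof eventually_elim
        case (elim x)
        have "\<bar>G (int (N x)) - x\<bar> \<le> M"
          using N[OF elim] gap_le[of "int (N x)"] by linarith
        then have "\<bar>G (int (N x)) - x\<bar> / real (N x) \<le> M / real (N x)"
          by (rule divide_right_mono) simp
        then show ?case by (simp flip: diff_divide_distrib)
      qed
    qed
  qed
  have "((\<lambda>x. ((?\<theta> x - \<xi>) / real (N x)) / (x / real (N x))) \<longlongrightarrow> \<beta> / \<gamma>) at_top"
    by (rule tendsto_divide[OF lim1 lim2 \<gamma>0])
  moreover have "\<forall>\<^sub>F x in at_top. ((?\<theta> x - \<xi>) / real (N x)) / (x / real (N x)) = (?\<theta> x - \<xi>) / x"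
  proof -
    have "\<forall>\<^sub>F x in at_top. 1 \<le> N x" using N_top unfolding filterlim_at_top by blast
    then show ?thesis by eventually_elim simp
  qed
  ultimately show ?thesis by (rule Lim_transform_eventually)
qed

lemma rotation_number_eq:
  assumes \<beta>: "(\<lambda>n. iter step 0 n 0 / real n) \<longlonglongrightarrow> \<beta>" and \<gamma>: "(\<lambda>n. G (int n) / real n) \<longlonglongrightarrow> \<gamma>"
  shows "rotation_number (b, V, G) 0 = \<beta> / \<gamma>"
  unfolding rotation_number_def
proof (rule the_equality)
  show "\<forall>\<xi>. ((\<lambda>x. (pruefer_angle (b, V, G) 0 \<xi> x - \<xi>) / x) \<longlongrightarrow> \<beta> / \<gamma>) at_top"
    using rotation_limit[OF assms] by blast
  show "\<rho> = \<beta> / \<gamma>" if "\<forall>\<xi>. ((\<lambda>x. (pruefer_angle (b, V, G) 0 \<xi> x - \<xi>) / x) \<longlongrightarrow> \<rho>) at_top" for \<rho>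
    using tendsto_unique[OF trivial_limit_at_top_linorder] that rotation_limit[OF assms, of 0] by blast
qed

end

section \<open>Dependence of the node-to-node maps on the coefficients\<close>


lemma jump_close:
  assumes c: "\<bar>c\<bar> \<le> Kv"
  shows "\<bar>transport 0 (\<lambda>_. c) 0 1 \<xi> - transport 0 (\<lambda>_. c') 0 1 \<eta>\<bar>
    \<le> exp (2 * Kv + 1) * (\<bar>\<xi> - \<eta>\<bar> + 2 * \<bar>c - c'\<bar>)"
proof -
  obtain u where u: "pruefer_arc 0 (\<lambda>_. c) 0 1 u" "u 0 = \<xi>" "transport 0 (\<lambda>_. c) 0 1 \<xi> = u 1"
    by (rule pruefer_interval.transport_arcE[OF jump_interval])
  obtain v where v: "pruefer_arc 0 (\<lambda>_. c') 0 1 v" "v 0 = \<eta>" "transport 0 (\<lambda>_. c') 0 1 \<eta> = v 1"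
    by (rule pruefer_interval.transport_arcE[OF jump_interval])
  have "\<bar>u 1 - v 1\<bar> \<le> exp ((2 * (\<bar>0\<bar> + Kv) + 1) * (1 - 0)) * (\<bar>u 0 - v 0\<bar> + \<bar>c - c'\<bar> * (1 + (1 - 0)))"
    by (rule pruefer_arc_comparison(1)[OF _ u(1) v(1)]) (use c in auto)
  then show ?thesis using u v by (simp add: mult.commute)
qed

text \<open>
  Two solutions on slightly different intervals, with coefficients that are only known to be close away
  from the ends: within \<open>2 r\<close> of the ends the bounded speed \<open>\<bar>A\<bar> + K\<close> alone limits the deviation to \<open>O(r)\<close>,
  and in between Gronwall applies.
\<close>

lemma pruefer_arc_endpoints_close:
  assumes u: "pruefer_arc A b \<alpha> \<beta> u" and v: "pruefer_arc A b' \<alpha>' \<beta>' v" and start: "u \<alpha> = v \<alpha>'"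
    and b: "\<And>x. \<alpha> < x \<Longrightarrow> x < \<beta> \<Longrightarrow> \<bar>b x\<bar> \<le> K" and b': "\<And>x. \<alpha>' < x \<Longrightarrow> x < \<beta>' \<Longrightarrow> \<bar>b' x\<bar> \<le> K"
    and K: "0 \<le> K" and r: "0 \<le> r" "4 * r \<le> \<beta> - \<alpha>" and M: "\<beta> - \<alpha> \<le> M"
    and ends: "\<bar>\<alpha> - \<alpha>'\<bar> \<le> r" "\<bar>\<beta> - \<beta>'\<bar> \<le> r"
    and close: "\<And>x. max \<alpha> \<alpha>' + r < x \<Longrightarrow> x < min \<beta> \<beta>' - r \<Longrightarrow> \<bar>b x - b' x\<bar> \<le> r"
  shows "\<bar>u \<beta> - v \<beta>'\<bar> \<le> (exp ((2 * (\<bar>A\<bar> + K) + 1) * M) * (4 * (\<bar>A\<bar> + K) + 1 + M) + 4 * (\<bar>A\<bar> + K)) * r"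
proof -
  define L where "L = \<bar>A\<bar> + K"
  define lo where "lo = max \<alpha> \<alpha>' + r"
  define hi where "hi = min \<beta> \<beta>' - r"
  have L: "0 \<le> L" using K by (simp add: L_def)
  have lo: "\<alpha> \<le> lo" "\<alpha>' \<le> lo" "lo - \<alpha> \<le> 2 * r" "lo - \<alpha>' \<le> 2 * r"
    using ends r by (auto simp: lo_def max_def)
  have hi: "hi \<le> \<beta>" "hi \<le> \<beta>'" "\<beta> - hi \<le> 2 * r" "\<beta>' - hi \<le> 2 * r"
    using ends r by (auto simp: hi_def min_def)
  have lohi: "lo \<le> hi" using lo hi r by linarith
  have hilo: "hi - lo \<le> M" using lo hi M by linarith
  have M0: "0 \<le> M" using lohi hilo by linarith
  have slow: "L * d \<le> L * (2 * r)" if "d \<le> 2 * r" for d using L that by (rule mult_left_mono[rotated])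
  have "\<bar>u lo - u \<alpha>\<bar> \<le> L * (lo - \<alpha>)"
    unfolding L_def by (rule pruefer_arc_speed[OF u b]) (use lo hi lohi in auto)
  moreover have "\<bar>v lo - v \<alpha>'\<bar> \<le> L * (lo - \<alpha>')"
    unfolding L_def by (rule pruefer_arc_speed[OF v b']) (use lo hi lohi in auto)
  ultimately have at_lo: "\<bar>u lo - v lo\<bar> \<le> 4 * L * r"
    using slow[OF lo(3)] slow[OF lo(4)] start by linarith
  have "\<bar>u hi - v hi\<bar> \<le> exp ((2 * (\<bar>A\<bar> + K) + 1) * (hi - lo)) * (\<bar>u lo - v lo\<bar> + r * (1 + (hi - lo)))"
  proof (rule pruefer_arc_comparison(1)[OF lohi])
    show "pruefer_arc A b lo hi u" by (rule pruefer_arc_subinterval[OF u lo(1) hi(1)])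
    show "pruefer_arc A b' lo hi v" by (rule pruefer_arc_subinterval[OF v lo(2) hi(2)])
    show "\<bar>b x\<bar> \<le> K" if "lo < x" "x < hi" for x using b[of x] that lo hi by simp
    show "\<bar>b x - b' x\<bar> \<le> r" if "lo < x" "x < hi" for x using close[of x] that by (simp add: lo_def hi_def)
  qed (use K r in auto)
  also have "\<dots> \<le> exp ((2 * (\<bar>A\<bar> + K) + 1) * M) * (4 * L * r + r * (1 + M))"
  proof (rule mult_mono)
    show "exp ((2 * (\<bar>A\<bar> + K) + 1) * (hi - lo)) \<le> exp ((2 * (\<bar>A\<bar> + K) + 1) * M)"
      using hilo K by (auto intro!: mult_left_mono)
    show "\<bar>u lo - v lo\<bar> + r * (1 + (hi - lo)) \<le> 4 * L * r + r * (1 + M)"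
      using at_lo hilo r by (intro add_mono mult_left_mono) auto
  qed (use r lohi in auto)
  finally have at_hi: "\<bar>u hi - v hi\<bar> \<le> exp ((2 * (\<bar>A\<bar> + K) + 1) * M) * (4 * L * r + r * (1 + M))" .
  have "\<bar>u \<beta> - u hi\<bar> \<le> L * (\<beta> - hi)"
    unfolding L_def by (rule pruefer_arc_speed[OF u b]) (use lo hi lohi in auto)
  moreover have "\<bar>v \<beta>' - v hi\<bar> \<le> L * (\<beta>' - hi)"
    unfolding L_def by (rule pruefer_arc_speed[OF v b']) (use lo hi lohi in auto)
  ultimately have "\<bar>u \<beta> - v \<beta>'\<bar> \<le> exp ((2 * (\<bar>A\<bar> + K) + 1) * M) * (4 * L * r + r * (1 + M)) + 4 * L * r"
    using slow[OF hi(3)] slow[OF hi(4)] at_hi by linarith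
  also have "\<dots> = (exp ((2 * (\<bar>A\<bar> + K) + 1) * M) * (4 * L + 1 + M) + 4 * L) * r"
    by (simp add: algebra_simps)
  finally show ?thesis unfolding L_def .
qed

text \<open>
  What membership of two shifts in an entourage means for a bounded real triple: the points match index
  by index, and \<open>q\<close> is compared only at distance more than \<open>r\<close> from both point sets. The condition
  concerns all indices, so it controls the steps at \<open>s + i\<close> and \<open>t + i\<close> for all \<open>i\<close> at once.
\<close>

definition shifts_close ::
    "(real \<Rightarrow> real) \<Rightarrow> (int \<Rightarrow> real) \<Rightarrow> (int \<Rightarrow> real) \<Rightarrow> real \<Rightarrow> int \<Rightarrow> int \<Rightarrow> bool" where
  "shifts_close q V G r s t \<longleftrightarrow>
     (\<forall>i. \<bar>(G (s + i) - G s) - (G (t + i) - G t)\<bar> \<le> r) \<and>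
     (\<forall>i. \<bar>V (s + i) - V (t + i)\<bar> \<le> r) \<and>
     (\<forall>x. (\<forall>i. r < \<bar>x - (G (s + i) - G s)\<bar> \<and> r < \<bar>x - (G (t + i) - G t)\<bar>) \<longrightarrow>
        \<bar>q (x + G s) - q (x + G t)\<bar> \<le> r)"

context pruefer_system
begin

lemma step_quasi_cocycle: "quasi_cocycle pi (\<lambda>n t. iter step t n 0)"
  by (rule iter_quasi_cocycle)

text \<open>
  The Lipschitz constant of the jump times the sum of the deviation of the arcs, from
  \<open>pruefer_arc_endpoints_close\<close> with \<open>A = 1\<close>, and the deviation of the interaction strengths.
\<close>

definition "shift_modulus = exp (2 * Kv + 1) *
  (exp ((2 * (1 + K) + 1) * M) * (4 * (1 + K) + 1 + M) + 4 * (1 + K) + 2)"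

lemma shift_modulus_pos: "0 < shift_modulus"
  unfolding shift_modulus_def using K_nonneg M_pos by (intro mult_pos_pos add_nonneg_pos add_nonneg_nonneg mult_nonneg_nonneg) auto

lemma step_shift_close:
  assumes close: "shifts_close b V G r s t" and r: "0 \<le> r" "4 * r \<le> m"
  shows "\<bar>step (s + i) \<xi> - step (t + i) \<xi>\<bar> \<le> shift_modulus * r"
proof -
  obtain u where u: "pruefer_arc 1 b (G (s + i)) (G (s + i + 1)) u" "u (G (s + i)) = \<xi>"
    "transport 1 b (G (s + i)) (G (s + i + 1)) \<xi> = u (G (s + i + 1))"
    by (rule interval.transport_arcE)
  obtain v where v: "pruefer_arc 1 b (G (t + i)) (G (t + i + 1)) v" "v (G (t + i)) = \<xi>"
    "transport 1 b (G (t + i)) (G (t + i + 1)) \<xi> = v (G (t + i + 1))"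
    by (rule interval.transport_arcE)
  let ?C = "exp ((2 * (1 + K) + 1) * M) * (4 * (1 + K) + 1 + M) + 4 * (1 + K)"
  \<comment> \<open>well inside the common part of the two cells, \<open>x\<close> is far from all points of both shifted sets\<close>
  have sep: "r < \<bar>x - (G (s + k) - G s)\<bar> \<and> r < \<bar>x - (G (t + k) - G t)\<bar>"
    if x: "max (G (s + i) - G s) (G (t + i) - G t) + r < x"
      "x < min (G (s + i + 1) - G s) (G (t + i + 1) - G t) - r" for x k
  proof -
    have le: "G (l + k) \<le> G (l + i) \<or> G (l + i + 1) \<le> G (l + k)" for l
      using point_sets_less_iff[OF G m, of "l + i" "l + k"]
        point_sets_less_iff[OF G m, of "l + k" "l + i + 1"] by force
    show ?thesis using le[of s] le[of t] x by auto
  qed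
  have "\<bar>u (G (s + i + 1) - G s + G s) - v (G (t + i + 1) - G t + G t)\<bar>
      \<le> (exp ((2 * (\<bar>1\<bar> + K) + 1) * M) * (4 * (\<bar>1\<bar> + K) + 1 + M) + 4 * (\<bar>1\<bar> + K)) * r"
  proof (rule pruefer_arc_endpoints_close[OF pruefer_arc_translate[OF u(1)] pruefer_arc_translate[OF v(1)]])
    show "u (G (s + i) - G s + G s) = v (G (t + i) - G t + G t)" using u v by simp
    show "\<bar>b (x + G s)\<bar> \<le> K" if "G (s + i) - G s < x" "x < G (s + i + 1) - G s" for x
      using interval.bound[of "s + i" "x + G s"] that by simp
    show "\<bar>b (x + G t)\<bar> \<le> K" if "G (t + i) - G t < x" "x < G (t + i + 1) - G t" for x
      using interval.bound[of "t + i" "x + G t"] that by simp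
    show "4 * r \<le> G (s + i + 1) - G s - (G (s + i) - G s)"
      using r point_sets_gap(1)[OF G, of "s + i"] by simp
    show "G (s + i + 1) - G s - (G (s + i) - G s) \<le> M" using gap_le[of "s + i"] by simp
    show "\<bar>G (s + i) - G s - (G (t + i) - G t)\<bar> \<le> r"
      using close unfolding shifts_close_def by blast
    show "\<bar>G (s + i + 1) - G s - (G (t + i + 1) - G t)\<bar> \<le> r"
      using close unfolding shifts_close_def by (simp add: add.assoc)
    show "\<bar>b (x + G s) - b (x + G t)\<bar> \<le> r"
      if "max (G (s + i) - G s) (G (t + i) - G t) + r < x"
        "x < min (G (s + i + 1) - G s) (G (t + i + 1) - G t) - r" for x
      using close sep[OF that] unfolding shifts_close_def by blast
  qed (use K_nonneg r in auto)
  then have *: "\<bar>u (G (s + i + 1)) - v (G (t + i + 1))\<bar> \<le> ?C * r" by simp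
  have V': "\<bar>V (s + i + 1) - V (t + i + 1)\<bar> \<le> r"
    using close unfolding shifts_close_def by (simp add: add.assoc)
  have "\<bar>step (s + i) \<xi> - step (t + i) \<xi>\<bar> \<le> exp (2 * Kv + 1) *
      (\<bar>u (G (s + i + 1)) - v (G (t + i + 1))\<bar> + 2 * \<bar>V (s + i + 1) - V (t + i + 1)\<bar>)"
    unfolding step_def u(3) v(3) by (rule jump_close[OF V_bound])
  also have "\<dots> \<le> exp (2 * Kv + 1) * (?C * r + 2 * r)"
    using * V' by (intro mult_left_mono add_mono) auto
  also have "\<dots> = shift_modulus * r" unfolding shift_modulus_def by (simp add: algebra_simps)
  finally show ?thesis .
qed

text \<open>
  If the shifts by \<open>s\<close> and \<open>a\<close> are close, then \<open>a - s\<close> is an almost period of the displacement over \<open>N\<close> steps.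
\<close>

lemma iter_shift_close:
  assumes close: "shifts_close b V G r s a" and r: "0 \<le> r" "4 * r \<le> m"
  shows "\<bar>iter step (t + (a - s)) N 0 - iter step t N 0\<bar> \<le> real N * step_lipschitz ^ N * (shift_modulus * r)"
proof (rule iter_perturbation[OF step_lipschitz_le step_lipschitz_ge_1])
  fix i \<xi>
  have "\<bar>step (s + (t - s + i)) \<xi> - step (a + (t - s + i)) \<xi>\<bar> \<le> shift_modulus * r"
    by (rule step_shift_close[OF close r])
  moreover have "s + (t - s + i) = t + i" "a + (t - s + i) = t + (a - s) + i" by simp_all
  ultimately show "\<bar>step (t + (a - s) + i) \<xi> - step (t + i) \<xi>\<bar> \<le> shift_modulus * r"
    by (simp only: abs_minus_commute)
qed

text \<open>
  For each block length \<open>N\<close> the closeness \<open>r\<close> of shifts is chosen so small that the displacement over \<open>N\<close>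
  steps changes by at most \<open>\<pi>\<close>, the defect that the cocycle has anyway. The bound must not depend on \<open>N\<close>,
  but \<open>r\<close> may.
\<close>

lemma step_mean_exists:
  assumes ap: "\<And>r. 0 < r \<Longrightarrow> \<exists>S. \<forall>a. \<exists>s. \<bar>s\<bar> \<le> S \<and> shifts_close b V G r s a"
  shows "\<exists>\<beta>. (\<lambda>n. iter step 0 n 0 / real n) \<longlonglongrightarrow> \<beta>"
proof -
  have "convergent (\<lambda>n. iter step 0 n 0 / real n)"
  proof (rule quasi_cocycle_convergent[where D = "\<lambda>n t. iter step t n 0", OF iter_quasi_cocycle])
    show "\<bar>iter step t 1 0\<bar> \<le> (1 + K) * M + Kv" for t using step_displacement[of t 0] by simp
    fix N :: nat
    \<comment> \<open>the summand 1 only keeps \<open>c\<close> positive when \<open>N = 0\<close>\<close>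
    define c where "c = real N * step_lipschitz ^ N * shift_modulus + 1"
    have c: "0 < c" unfolding c_def using shift_modulus_pos step_lipschitz_ge_1
      by (intro add_nonneg_pos mult_nonneg_nonneg) auto
    define r where "r = min (m / 4) (pi / c)"
    have r: "0 < r" "4 * r \<le> m" using m c by (auto simp: r_def)
    have "c * r \<le> pi"
    proof -
      have "r \<le> pi / c" by (simp add: r_def)
      then show ?thesis using c by (simp add: field_simps)
    qed
    moreover have "real N * step_lipschitz ^ N * (shift_modulus * r) \<le> c * r"
      using r by (simp add: c_def algebra_simps)
    ultimately have small: "real N * step_lipschitz ^ N * (shift_modulus * r) \<le> pi" by linarith
    obtain S where S: "\<forall>a. \<exists>s. \<bar>s\<bar> \<le> S \<and> shifts_close b V G r s a" using ap[OF r(1)] by blast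
    have "\<exists>s. \<bar>s - a\<bar> \<le> S \<and> (\<forall>t. \<bar>iter step (t + s) N 0 - iter step t N 0\<bar> \<le> pi)" for a
    proof -
      obtain s where s: "\<bar>s\<bar> \<le> S" "shifts_close b V G r s a" using S by blast
      have "\<bar>iter step (t + (a - s)) N 0 - iter step t N 0\<bar> \<le> pi" for t
        using iter_shift_close[OF s(2) less_imp_le[OF r(1)] r(2), of t N] small by linarith
      then show ?thesis using s(1) by (intro exI[of _ "a - s"]) auto
    qed
    then show "\<exists>S. \<forall>a. \<exists>s. \<bar>s - a\<bar> \<le> S \<and> (\<forall>t. \<bar>iter step (t + s) N 0 - iter step t N 0\<bar> \<le> pi)" by blast
  qed
  then show ?thesis by (simp add: convergent_def)
qed

lemma step_coefficient_close:
  assumes b': "pruefer_system m M K Kv G V b'" and e: "0 \<le> e"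
    and close: "\<And>x. x \<notin> range G \<Longrightarrow> \<bar>b x - b' x\<bar> \<le> e"
  shows "\<bar>step n \<xi> - pruefer_system.step G V b' n \<xi>\<bar> \<le> step_lipschitz * (1 + M) * e"
proof -
  interpret b': pruefer_system m M K Kv G V b' by (rule b')
  obtain u where u: "pruefer_arc 1 b (G n) (G (n + 1)) u" "u (G n) = \<xi>"
    "transport 1 b (G n) (G (n + 1)) \<xi> = u (G (n + 1))"
    by (rule interval.transport_arcE)
  obtain v where v: "pruefer_arc 1 b' (G n) (G (n + 1)) v" "v (G n) = \<xi>"
    "transport 1 b' (G n) (G (n + 1)) \<xi> = v (G (n + 1))"
    by (rule b'.interval.transport_arcE)
  have "\<bar>u (G (n + 1)) - v (G (n + 1))\<bar> \<le> exp ((2 * (\<bar>1\<bar> + K) + 1) * (G (n + 1) - G n)) *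
      (\<bar>u (G n) - v (G n)\<bar> + e * (1 + (G (n + 1) - G n)))"
    by (rule pruefer_arc_comparison(1)[OF _ u(1) v(1)])
       (use G_less[of n] interval.bound K_nonneg close cell_not_point e in auto)
  also have "\<dots> \<le> exp ((2 * (1 + K) + 1) * M) * (e * (1 + M))"
    using interval_growth_le[of n] e gap_le[of n] G_less[of n] u v
    by (auto intro!: mult_mono mult_left_mono)
  finally have *: "\<bar>u (G (n + 1)) - v (G (n + 1))\<bar> \<le> exp ((2 * (1 + K) + 1) * M) * (e * (1 + M))" .
  have "\<bar>step n \<xi> - b'.step n \<xi>\<bar> \<le> exp (2 * Kv + 1) *
      (\<bar>u (G (n + 1)) - v (G (n + 1))\<bar> + 2 * \<bar>V (n + 1) - V (n + 1)\<bar>)"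
    unfolding step_def b'.step_def u(3) v(3) by (rule jump_close[OF V_bound])
  also have "\<dots> \<le> exp (2 * Kv + 1) * (exp ((2 * (1 + K) + 1) * M) * (e * (1 + M)))"
    using * by simp
  finally show ?thesis by (simp add: step_lipschitz_def algebra_simps)
qed

end

section \<open>From the hull to the rotation number\<close>

text \<open>
  The radius \<open>r0\<close> is cut down to \<open>m / 2\<close> so that close point sets match index by index.
\<close>

lemma PC_ap_shifts_close_real:
  assumes m: "0 < m" and d: "PC_metric m M d" and p: "(q, V, G) \<in> PC_ap m M d" and r: "0 < r"
  shows "\<exists>S. \<forall>a. \<exists>s. \<bar>s\<bar> \<le> S \<and> shifts_close q V G r s a"
proof -
  define r0 where "r0 = min r (m / 2)"
  have r0: "0 < r0" using r m by (simp add: r0_def)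
  have pPC: "(q, V, G) \<in> PC m M" using p by (simp add: PC_ap_def)
  have G: "G \<in> point_sets m M" and V: "bounded (range V)" using pPC by (simp_all add: PC_iff)
  obtain r' :: real and S :: int where r': "0 < r'" "r' \<le> r0"
    and S: "\<forall>a. \<exists>s. \<bar>s\<bar> \<le> S \<and> (pc_shift (q, V, G) s, pc_shift (q, V, G) a) \<in> entourage_S m M r'"
    using PC_ap_shifts_close[OF d p r0] by (elim exE conjE)
  have "shifts_close q V G r s a"
    if e: "(pc_shift (q, V, G) s, pc_shift (q, V, G) a) \<in> entourage_S m M r'" for s a
  proof -
    have dist: "point_set_dist (point_set_shift G s) (point_set_shift G a) < r'"
      and Vd: "(SUP i. norm (bishift V s i - bishift V a i)) < r'"
      and qd: "\<And>x. x \<notin> fattening r' (range (point_set_shift G s) \<union> range (point_set_shift G a))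
        \<Longrightarrow> norm (q (x + G s) - q (x + G a)) < r'"
      using e by (simp_all add: entourage_S_def)
    have r'm: "2 * r' \<le> m" using r' by (simp add: r0_def)
    have Gd: "\<bar>point_set_shift G s i - point_set_shift G a i\<bar> < r'" for i
      by (rule point_set_dist_matching[OF point_set_shift_in[OF G] point_set_shift_in[OF G] m dist r'm])
    have 1: "\<bar>(G (s + i) - G s) - (G (a + i) - G a)\<bar> \<le> r" for i
    proof -
      have "\<bar>(G (i + s) - G s) - (G (i + a) - G a)\<bar> < r'"
        using Gd[of i] by (simp add: point_set_shift_def)
      then show ?thesis using r' by (simp add: r0_def add.commute)
    qed
    obtain B where B: "\<And>i. \<bar>V i\<bar> \<le> B" using V by (auto simp: bounded_iff)
    have "norm (bishift V s i - bishift V a i) \<le> 2 * B" for i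
      using B[of "i + s"] B[of "i + a"] by (simp add: bishift_def)
    then have bdd: "bdd_above (range (\<lambda>i. norm (bishift V s i - bishift V a i)))"
      by (intro bdd_aboveI[of _ "2 * B"]) (elim rangeE, simp)
    have Vd': "norm (bishift V s i - bishift V a i) < r'" for i
      using cSUP_upper[OF UNIV_I bdd, of i] Vd by (rule le_less_trans)
    have 2: "\<bar>V (s + i) - V (a + i)\<bar> \<le> r" for i
    proof -
      have "\<bar>V (i + s) - V (i + a)\<bar> < r'" using Vd'[of i] by (simp add: bishift_def)
      then show ?thesis using r' by (simp add: r0_def add.commute)
    qed
    have 3: "\<bar>q (x + G s) - q (x + G a)\<bar> \<le> r"
      if x: "\<forall>i. r < \<bar>x - (G (s + i) - G s)\<bar> \<and> r < \<bar>x - (G (a + i) - G a)\<bar>" for x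
    proof -
      have "x \<notin> fattening r' (range (point_set_shift G s) \<union> range (point_set_shift G a))"
      proof
        assume "x \<in> fattening r' (range (point_set_shift G s) \<union> range (point_set_shift G a))"
        then obtain i where "\<bar>x - (G (s + i) - G s)\<bar> \<le> r' \<or> \<bar>x - (G (a + i) - G a)\<bar> \<le> r'"
          by (auto simp: fattening_def point_set_shift_def add.commute)
        then show False using spec[OF x, of i] r' by (auto simp: r0_def)
      qed
      from qd[OF this] show ?thesis using r' by (simp add: r0_def)
    qed
    show ?thesis unfolding shifts_close_def by (intro conjI allI impI 1 2) (erule 3)
  qed
  note close = this
  show ?thesis
  proof (rule exI[of _ S], rule allI)
    fix a
    obtain s where "\<bar>s\<bar> \<le> S" "(pc_shift (q, V, G) s, pc_shift (q, V, G) a) \<in> entourage_S m M r'"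
      using spec[OF S, of a] by (elim exE conjE)
    then show "\<exists>s. \<bar>s\<bar> \<le> S \<and> shifts_close q V G r s a"
      by (intro exI[of _ s] conjI close)
  qed
qed

lemma rotation_number_absorb_energy:
  "rotation_number (q, V, G) E = rotation_number (\<lambda>x. q x - E, V, G) 0"
  by (simp add: rotation_number_def pruefer_angle_def pruefer_solution_def)

lemma PC_pruefer_system:
  fixes q :: "real \<Rightarrow> real"
  assumes m: "0 < m" and p: "(q, V, G) \<in> PC m M"
  shows "\<exists>B Kv. \<forall>E R. \<bar>E\<bar> \<le> R \<longrightarrow> pruefer_system m M (B + R) Kv G V (\<lambda>x. q x - E)"
proof -
  have G: "G \<in> point_sets m M" and V: "bounded (range V)" and qb: "bounded (q ` (- range G))"
    and uc: "\<forall>\<epsilon>>0. \<exists>\<delta>>0. \<forall>x y. connected_component (- range G) x y \<and> \<bar>x - y\<bar> < \<delta>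
        \<longrightarrow> norm (q x - q y) < \<epsilon>"
    using p by (simp_all add: PC_iff)
  obtain B where B: "0 < B" "\<And>x. x \<notin> range G \<Longrightarrow> \<bar>q x\<bar> \<le> B"
    using qb unfolding bounded_pos by auto
  obtain Kv where Kv: "\<And>i. \<bar>V i\<bar> \<le> Kv" using V by (auto simp: bounded_iff)
  have unif: "uniformly_continuous_on {G n<..<G (n + 1)} (\<lambda>x. q x - E)" for n E
    unfolding uniformly_continuous_on_def
  proof (intro allI impI)
    fix e :: real assume "0 < e"
    then obtain k where k: "k > 0" "\<forall>x y. connected_component (- range G) x y \<and> \<bar>x - y\<bar> < k
        \<longrightarrow> norm (q x - q y) < e"
      using uc by blast
    have sub: "{G n<..<G (n + 1)} \<subseteq> - range G"
    proof
      fix x assume "x \<in> {G n<..<G (n + 1)}"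
      then show "x \<in> - range G" using point_sets_open_cell[OF G m, of n x] by simp
    qed
    have "connected_component (- range G) x y"
      if xy: "x \<in> {G n<..<G (n + 1)}" "y \<in> {G n<..<G (n + 1)}" for x y
      unfolding connected_component_def
      by (intro exI[of _ "{G n<..<G (n + 1)}"] conjI sub xy) simp
    then show "\<exists>d>0. \<forall>x\<in>{G n<..<G (n + 1)}. \<forall>x'\<in>{G n<..<G (n + 1)}. dist x' x < d \<longrightarrow>
        dist (q x' - E) (q x - E) < e"
      using k by (intro exI[of _ k]) (auto simp: dist_real_def)
  qed
  show ?thesis
  proof (rule exI[of _ B], rule exI[of _ Kv], intro allI impI)
    fix E R :: real assume E: "\<bar>E\<bar> \<le> R"
    show "pruefer_system m M (B + R) Kv G V (\<lambda>x. q x - E)"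
    proof
      show "\<bar>q x - E\<bar> \<le> B + R" if "x \<notin> range G" for x using B(2)[OF that] E by linarith
      show "0 \<le> B + R" using B(1) E by linarith
    qed (fact m G unif Kv)+
  qed
qed

text \<open>
  Gaps form an exactly additive cocycle, to which the convergence theorem applies with any positive
  defect.
\<close>

lemma point_density_exists:
  assumes m: "0 < m" and G: "G \<in> point_sets m M"
    and ap: "\<And>r. 0 < r \<Longrightarrow> \<exists>S. \<forall>a. \<exists>s. \<bar>s\<bar> \<le> S \<and> shifts_close q V G r s a"
  shows "\<exists>\<gamma>>0. (\<lambda>n. G (int n) / real n) \<longlonglongrightarrow> \<gamma>"
proof -
  have G0: "G 0 = 0" using G by (simp add: point_sets_def)
  have "convergent (\<lambda>n. (G (0 + int n) - G 0) / real n)"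
  proof (rule quasi_cocycle_convergent[where D = "\<lambda>n t. G (t + int n) - G t" and c = 1])
    show "quasi_cocycle 1 (\<lambda>n t. G (t + int n) - G t)"
      by (simp add: quasi_cocycle_def algebra_simps)
    show "\<bar>G (t + int 1) - G t\<bar> \<le> M" for t
      using point_sets_gap[OF G, of t] m by simp
    fix N :: nat
    obtain S where S: "\<forall>a. \<exists>s. \<bar>s\<bar> \<le> S \<and> shifts_close q V G (1/2) s a" using ap[of "1/2"] by auto
    have "\<exists>s. \<bar>s - a\<bar> \<le> S \<and> (\<forall>t. \<bar>(G (t + s + int N) - G (t + s)) - (G (t + int N) - G t)\<bar> \<le> 1)" for a
    proof -
      obtain s where s: "\<bar>s\<bar> \<le> S" "shifts_close q V G (1/2) s a" using S by blast
      have c: "\<bar>(G (s + i) - G s) - (G (a + i) - G a)\<bar> \<le> 1/2" for i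
        using s(2) unfolding shifts_close_def by blast
      have "\<bar>(G (t + (a - s) + int N) - G (t + (a - s))) - (G (t + int N) - G t)\<bar> \<le> 1" for t
      proof -
        have "s + (t - s) = t" "a + (t - s) = t + (a - s)" "s + (t - s + int N) = t + int N"
          "a + (t - s + int N) = t + (a - s) + int N" by simp_all
        then show ?thesis using c[of "t - s"] c[of "t - s + int N"] by (simp only:)
      qed
      then show ?thesis using s(1) by (intro exI[of _ "a - s"]) auto
    qed
    then show "\<exists>S. \<forall>a. \<exists>s. \<bar>s - a\<bar> \<le> S \<and>
        (\<forall>t. \<bar>(G (t + s + int N) - G (t + s)) - (G (t + int N) - G t)\<bar> \<le> 1)" by blast
  qed
  then obtain \<gamma> where \<gamma>: "(\<lambda>n. G (int n) / real n) \<longlonglongrightarrow> \<gamma>" by (auto simp: convergent_def G0)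
  have "m \<le> \<gamma>"
  proof (rule LIMSEQ_le_const[OF \<gamma>], intro exI[of _ 1] allI impI)
    fix n :: nat assume "1 \<le> n"
    then show "m \<le> G (int n) / real n"
      using point_sets_gap_nat(1)[OF G, of n 0] G0 by (simp add: field_simps)
  qed
  then show ?thesis using \<gamma> m by (intro exI[of _ \<gamma>]) auto
qed

theorem theorem5p4:
  fixes m M :: real
    and d :: "real pc_triple \<Rightarrow> real pc_triple \<Rightarrow> real"
    and q :: "real \<Rightarrow> real" and V :: "int \<Rightarrow> real" and G :: "int \<Rightarrow> real"
  assumes "0 < m" and "m \<le> M"
    and "PC_metric m M d"
    and "(q, V, G) \<in> PC_ap m M d"
  shows "continuous_on UNIV (rotation_number (q, V, G))"
proof -
  have ap: "\<exists>S. \<forall>a. \<exists>s. \<bar>s\<bar> \<le> S \<and> shifts_close q V G r s a" if "0 < r" for r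
    by (rule PC_ap_shifts_close_real[OF assms(1,3,4) that])
  have pPC: "(q, V, G) \<in> PC m M" using assms(4) by (simp add: PC_ap_def)
  have G: "G \<in> point_sets m M" using pPC by (simp add: PC_iff)
  obtain B Kv where sys: "\<And>E R. \<bar>E\<bar> \<le> R \<Longrightarrow> pruefer_system m M (B + R) Kv G V (\<lambda>x. q x - E)"
    using PC_pruefer_system[OF assms(1) pPC] by blast
  obtain \<gamma> where \<gamma>: "0 < \<gamma>" "(\<lambda>n. G (int n) / real n) \<longlonglongrightarrow> \<gamma>"
    using point_density_exists[OF assms(1) G ap] by blast
  define D where "D E n t = iter (pruefer_system.step G V (\<lambda>x. q x - E)) t n 0" for E n t
  have cocycle: "quasi_cocycle pi (D E)" for E
    unfolding D_def by (rule pruefer_system.step_quasi_cocycle[OF sys[OF order_refl]])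
  have "\<exists>\<beta>. (\<lambda>n. D E n 0 / real n) \<longlonglongrightarrow> \<beta>" for E
    unfolding D_def
  proof (rule pruefer_system.step_mean_exists[OF sys[OF order_refl]])
    show "\<exists>S. \<forall>a. \<exists>s. \<bar>s\<bar> \<le> S \<and> shifts_close (\<lambda>x. q x - E) V G r s a" if "0 < r" for r
      using ap[OF that] by (simp add: shifts_close_def)
  qed
  then have "\<forall>E. \<exists>\<beta>. (\<lambda>n. D E n 0 / real n) \<longlonglongrightarrow> \<beta>" by blast
  from choice[OF this] obtain \<beta> where \<beta>: "\<And>E. (\<lambda>n. D E n 0 / real n) \<longlonglongrightarrow> \<beta> E" by blast
  have \<rho>: "rotation_number (q, V, G) E = \<beta> E / \<gamma>" for E
    unfolding rotation_number_absorb_energy[of q]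
    by (rule pruefer_system.rotation_number_eq[OF sys[OF order_refl] \<beta>[unfolded D_def] \<gamma>(2)])
  show ?thesis
    unfolding continuous_on_iff \<rho>
  proof (intro ballI allI impI)
    fix E0 e :: real assume e: "0 < e"
    \<comment> \<open>one bound for all energies within 1 of \<open>E0\<close>\<close>
    define K where "K = B + (\<bar>E0\<bar> + 1)"
    have sysK: "pruefer_system m M K Kv G V (\<lambda>x. q x - E)" if "\<bar>E - E0\<bar> \<le> 1" for E
      unfolding K_def by (rule sys) (use that in linarith)
    interpret E0: pruefer_system m M K Kv G V "\<lambda>x. q x - E0" by (rule sysK) simp
    obtain N :: nat where N: "(2 * pi + 1) / (\<gamma> * e) < real N" using reals_Archimedean2 by blast
    have "0 < 2 * pi + 1" using pi_gt_zero by linarith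
    then have "0 < (2 * pi + 1) / (\<gamma> * e)" using e \<gamma>(1) by (intro divide_pos_pos mult_pos_pos)
    then have N1: "1 \<le> N" using N by (cases N) auto
    have Ne: "(2 * pi + 1) / real N / \<gamma> < e" using N N1 e \<gamma> by (simp add: field_simps)
    define c where "c = real N * E0.step_lipschitz ^ N * (E0.step_lipschitz * (1 + M))"
    have c: "0 < c" unfolding c_def using N1 E0.step_lipschitz_ge_1 E0.M_pos
      by (intro mult_pos_pos zero_less_power) auto
    show "\<exists>k>0. \<forall>E\<in>UNIV. dist E E0 < k \<longrightarrow> dist (\<beta> E / \<gamma>) (\<beta> E0 / \<gamma>) < e"
    proof (intro exI[of _ "min 1 (1 / c)"] conjI ballI impI)
      show "0 < min 1 (1 / c)" using c by simp
      fix E :: real assume "dist E E0 < min 1 (1 / c)"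
      then have E: "\<bar>E - E0\<bar> \<le> 1" "\<bar>E - E0\<bar> < 1 / c" by (simp_all add: dist_real_def)
      have "\<bar>D E0 N t - D E N t\<bar> \<le> 1" for t
      proof -
        have "\<bar>D E0 N t - D E N t\<bar> \<le> real N * E0.step_lipschitz ^ N * (E0.step_lipschitz * (1 + M) * \<bar>E - E0\<bar>)"
          unfolding D_def
          by (rule iter_perturbation[OF E0.step_lipschitz_le E0.step_lipschitz_ge_1],
              rule E0.step_coefficient_close[OF sysK[OF E(1)]]) auto
        also have "\<dots> = c * \<bar>E - E0\<bar>" by (simp add: c_def)
        also have "\<dots> \<le> 1" using E(2) c by (simp add: field_simps)
        finally show ?thesis .
      qed
      then have "\<bar>\<beta> E0 - \<beta> E\<bar> \<le> (2 * pi + 1) / real N"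
        by (rule quasi_cocycle_mean_close[OF cocycle cocycle N1 _ \<beta> \<beta>])
      then have "\<bar>\<beta> E0 - \<beta> E\<bar> / \<gamma> \<le> (2 * pi + 1) / real N / \<gamma>"
        using \<gamma> by (intro divide_right_mono) auto
      then have "\<bar>\<beta> E0 - \<beta> E\<bar> / \<gamma> < e" using Ne by linarith
      then show "dist (\<beta> E / \<gamma>) (\<beta> E0 / \<gamma>) < e"
        using \<gamma>(1) by (simp add: dist_real_def abs_minus_commute flip: diff_divide_distrib)
    qed
  qed
qed

end
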